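(* There is no free arrangement in $\mathbb{P}^2_{\mathbb{C}}$ consisting of one line $\ell$ and one smooth plane quartic curve $Q$; that is, for every line $\ell$ and every smooth plane quartic $Q$ the reduced curve $\ell\cup Q$ is not free.
   Context: Let $S=\mathbb{C}[x,y,z]$. For a reduced curve $C: f=0$ of degree $d$ in $\mathbb{P}^2_{\mathbb{C}}$, let $J_f$ be the ideal generated by the partial derivatives of $f$ and $M(f)=S/J_f$ the Milnor algebra. $C$ is an $m$-syzygy curve if $M(f)$ has minimal graded free resolution $$0 \rightarrow \bigoplus_{i=1}^{m-2}S(-e_{i}) \rightarrow \bigoplus_{i=1}^{m}S(1-d - d_{i}) \rightarrow S^{3}(1-d)\rightarrow S \rightarrow M(f) \rightarrow 0$$ with $e_{1} \leq \dots \leq e_{m-2}$ and $1\leq d_{1} \leq \dots \leq d_{m}$. $C$ is free if $m=2$ and $d_1+d_2=d-1$. An arrangement of curves is called free if the reduced curve that is the union of its members is free. *)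

theory Defs
  imports
    "HOL-Computational_Algebra.Computational_Algebra"
    "HOL-Computational_Algebra.Field_as_Ring"
    "Jordan_Normal_Form.Matrix_Kernel"
begin

text \<open>
  \<open>S = \<complex>[x,y,z]\<close> is rendered as \<open>\<complex>[x][y][z]\<close>: the outermost polynomial variable is \<open>z\<close>,
  the innermost one is \<open>x\<close>. A curve in the projective plane is given by a homogeneous equation.
\<close>

type_synonym cpoly3 = "complex poly poly poly"

definition coeff3 :: "cpoly3 \<Rightarrow> nat \<Rightarrow> nat \<Rightarrow> nat \<Rightarrow> complex" where
  "coeff3 p i j k = coeff (coeff (coeff p k) j) i"

definition eval3 :: "cpoly3 \<Rightarrow> complex \<Rightarrow> complex \<Rightarrow> complex \<Rightarrow> complex" where
  "eval3 p x y z = poly (poly (poly p [:[:z:]:]) [:y:]) x"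

text \<open>Degrees are integers because twists of \<open>S\<close> occur; only \<open>0\<close> has negative degree.\<close>

definition homogeneous :: "int \<Rightarrow> cpoly3 \<Rightarrow> bool" where
  "homogeneous n p \<longleftrightarrow> (\<forall>i j k. coeff3 p i j k \<noteq> 0 \<longrightarrow> int (i + j + k) = n)"

definition partial_x :: "cpoly3 \<Rightarrow> cpoly3" where
  "partial_x = map_poly (map_poly pderiv)"

definition partial_y :: "cpoly3 \<Rightarrow> cpoly3" where
  "partial_y = map_poly pderiv"

definition partial_z :: "cpoly3 \<Rightarrow> cpoly3" where
  "partial_z = pderiv"

definition jacobian_ideal :: "cpoly3 \<Rightarrow> cpoly3 set" where
  "jacobian_ideal f = {a * partial_x f + b * partial_y f + c * partial_z f | a b c. True}"

definition irrelevant_ideal :: "cpoly3 set" where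
  "irrelevant_ideal = {p. coeff3 p 0 0 0 = 0}"


subsection \<open>Plane curves\<close>

definition plane_curve :: "nat \<Rightarrow> cpoly3 \<Rightarrow> bool" where
  "plane_curve d f \<longleftrightarrow> 1 \<le> d \<and> f \<noteq> 0 \<and> homogeneous (int d) f"

definition reduced_plane_curve :: "nat \<Rightarrow> cpoly3 \<Rightarrow> bool" where
  "reduced_plane_curve d f \<longleftrightarrow> plane_curve d f \<and> squarefree f"

definition singular_point :: "cpoly3 \<Rightarrow> complex \<Rightarrow> complex \<Rightarrow> complex \<Rightarrow> bool" where
  "singular_point f x y z \<longleftrightarrow>
     (x, y, z) \<noteq> (0, 0, 0) \<and> eval3 f x y z = 0 \<and>
     eval3 (partial_x f) x y z = 0 \<and> eval3 (partial_y f) x y z = 0 \<and> eval3 (partial_z f) x y z = 0"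

definition smooth_plane_curve :: "nat \<Rightarrow> cpoly3 \<Rightarrow> bool" where
  "smooth_plane_curve d f \<longleftrightarrow> plane_curve d f \<and> (\<nexists>x y z. singular_point f x y z)"


subsection \<open>Minimal graded free resolutions and syzygy curves\<close>

text \<open>
  A list \<open>a = [a\<^sub>1, \<dots>, a\<^sub>n]\<close> of integers stands for the graded free module
  \<open>S(-a\<^sub>1) \<oplus> \<dots> \<oplus> S(-a\<^sub>n)\<close>, whose elements are the vectors in \<open>carrier_vec n\<close> over \<open>S\<close>.
  A homomorphism of graded modules (of degree \<open>0\<close>) from the module of \<open>a\<close> to that of \<open>b\<close> is
  multiplication by a matrix whose \<open>(i,j)\<close> entry is homogeneous of degree \<open>a\<^sub>j - b\<^sub>i\<close>. It is
  minimal if it maps into the irrelevant ideal times the target.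
\<close>

definition graded_hom :: "int list \<Rightarrow> int list \<Rightarrow> cpoly3 mat \<Rightarrow> bool" where
  "graded_hom a b A \<longleftrightarrow>
     A \<in> carrier_mat (length b) (length a) \<and>
     (\<forall>i < length b. \<forall>j < length a. homogeneous (a ! j - b ! i) (A $$ (i, j)))"

definition minimal_graded_hom :: "int list \<Rightarrow> int list \<Rightarrow> cpoly3 mat \<Rightarrow> bool" where
  "minimal_graded_hom a b A \<longleftrightarrow>
     graded_hom a b A \<and> (\<forall>i < length b. \<forall>j < length a. A $$ (i, j) \<in> irrelevant_ideal)"

definition mat_image :: "cpoly3 mat \<Rightarrow> cpoly3 vec set" where
  "mat_image A = (\<lambda>v. A *\<^sub>v v) ` carrier_vec (dim_col A)"

text \<open>
  Minimal graded free resolution \<open>0 \<rightarrow> F\<^sub>3 \<rightarrow> F\<^sub>2 \<rightarrow> F\<^sub>1 \<rightarrow> S \<rightarrow> S/I \<rightarrow> 0\<close> of the quotient by an ideal \<open>I\<close>,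
  where \<open>S \<rightarrow> S/I\<close> is the canonical projection and \<open>F\<^sub>i\<close> is given by its list of shifts.
  The first condition after the gradings is exactness at \<open>S\<close>, i.e. the image of
  \<open>F\<^sub>1 \<rightarrow> S\<close> is the kernel \<open>I\<close> of the projection; here \<open>S\<close> is the module of vectors of length \<open>1\<close>.
\<close>

definition minimal_free_resolution ::
    "cpoly3 set \<Rightarrow> int list \<Rightarrow> int list \<Rightarrow> int list \<Rightarrow> bool" where
  "minimal_free_resolution I F1 F2 F3 \<longleftrightarrow>
     (\<exists>A1 A2 A3.
        minimal_graded_hom F1 [0] A1 \<and>
        minimal_graded_hom F2 F1 A2 \<and>
        minimal_graded_hom F3 F2 A3 \<and>
        mat_image A1 = {v \<in> carrier_vec 1. v $ 0 \<in> I} \<and>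
        mat_image A2 = mat_kernel A1 \<and>
        mat_image A3 = mat_kernel A2 \<and>
        mat_kernel A3 = {0\<^sub>v (length F3)})"

text \<open>
  The Milnor algebra is \<open>M(f) = S / J\<^sub>f\<close>. The lists \<open>ds\<close> and \<open>es\<close> are
  \<open>d\<^sub>1 \<le> \<dots> \<le> d\<^sub>m\<close> and \<open>e\<^sub>1 \<le> \<dots> \<le> e\<^bsub>m-2\<^esub>\<close>; the shift \<open>S(1 - d - d\<^sub>i)\<close> is
  \<open>S(-a)\<close> with \<open>a = d - 1 + d\<^sub>i\<close>.
\<close>

definition syzygy_curve :: "nat \<Rightarrow> nat \<Rightarrow> nat list \<Rightarrow> int list \<Rightarrow> cpoly3 \<Rightarrow> bool" where
  "syzygy_curve m d ds es f \<longleftrightarrow>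
     reduced_plane_curve d f \<and>
     2 \<le> m \<and> length ds = m \<and> length es = m - 2 \<and>
     sorted ds \<and> (\<forall>a \<in> set ds. 1 \<le> a) \<and> sorted es \<and>
     minimal_free_resolution (jacobian_ideal f)
       (replicate 3 (int d - 1)) (map (\<lambda>a. int d - 1 + int a) ds) es"

definition free_curve :: "cpoly3 \<Rightarrow> bool" where
  "free_curve f \<longleftrightarrow>
     (\<exists>d d1 d2. syzygy_curve 2 d [d1, d2] [] f \<and> int d1 + int d2 = int d - 1)"


subsection \<open>Arrangements\<close>

text \<open>
  The reduced curve with the same points as \<open>g = 0\<close> has as equation the product of the distinct
  prime factors of \<open>g\<close>; the union of the curves in \<open>A\<close> is the zero locus of the product of
  their equations.
\<close>

definition reduced_equation :: "cpoly3 \<Rightarrow> cpoly3" where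
  "reduced_equation g = \<Prod>(prime_factors g)"

definition free_arrangement :: "cpoly3 set \<Rightarrow> bool" where
  "free_arrangement A \<longleftrightarrow> free_curve (reduced_equation (\<Prod>A))"

end

theory Submission
  imports Defs "Jordan_Normal_Form.Char_Poly"
begin

text \<open>
  Let \<open>f = l q\<close>. If \<open>f\<close> were free, its exponents would satisfy \<open>d\<^sub>1 + d\<^sub>2 = 4\<close>, so some nonzero derivation
  \<open>\<theta>\<close> with homogeneous coefficients of degree at most 2 would kill \<open>f\<close>. From \<open>\<theta>(l) q + l \<theta>(q) = 0\<close> one
  gets \<open>\<theta>(l) = g l\<close> and \<open>\<theta>(q) = - g q\<close>, so \<open>4 \<theta> + g E\<close>, with \<open>E\<close> the Euler derivation, kills \<open>q\<close>. Its
  coefficients have degree less than 3, while the partial derivatives of the smooth quartic \<open>q\<close> are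
  three cubics without common zero, hence a regular sequence, whose syzygies all have degree at least 3.
  So \<open>4 \<theta> = - g E\<close>, which evaluated on \<open>l\<close> gives \<open>5 g l = 0\<close>, and \<open>\<theta> = 0\<close>.

  For the statement on syzygies of \<open>p, q, w\<close> of degree \<open>n\<close>, assume \<open>p(0,0,1) \<noteq> 0\<close> and add a general multiple of
  \<open>w\<close> to \<open>q\<close>, so that \<open>p\<close> and \<open>q\<close> are coprime after setting \<open>x = 0\<close> and after setting \<open>x = 1\<close>. The
  Nullstellensatz in the chart \<open>x = 1\<close> gives \<open>x\<^sup>N \<in> (p, q, w)\<close>, so a syzygy \<open>a p + b q + c w = 0\<close> yields
  \<open>x\<^sup>N c \<in> (p, q)\<close>. As \<open>x\<close> is a nonzerodivisor modulo \<open>(p, q)\<close>, already \<open>c \<in> (p, q)\<close>, which forces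
  \<open>c = 0\<close> in degrees below \<open>n\<close>.
\<close>

subsection \<open>Gradings\<close>

definition lift_grading :: "(int \<Rightarrow> 'a::zero \<Rightarrow> bool) \<Rightarrow> int \<Rightarrow> 'a poly \<Rightarrow> bool" where
  "lift_grading G n p \<longleftrightarrow> (\<forall>k. G (n - int k) (coeff p k))"

text \<open>The pieces may overlap, so the locale covers both the grading by degree and the
  filtration by order at the origin. In \<open>lift_grading\<close> the new variable gets degree 1;
  three lifts reach \<open>cpoly3\<close>.\<close>

locale grading =
  fixes G :: "int \<Rightarrow> 'a::comm_ring_1 \<Rightarrow> bool"
  assumes zero: "G n 0"
    and add: "G n a \<Longrightarrow> G n b \<Longrightarrow> G n (a + b)"
    and uminus: "G n a \<Longrightarrow> G n (- a)"
    and mult: "G n a \<Longrightarrow> G m b \<Longrightarrow> G (n + m) (a * b)"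
begin

lemma diff: "G n a \<Longrightarrow> G n b \<Longrightarrow> G n (a - b)"
  using add[of n a "- b"] uminus[of n b] by simp

lemma sum: "(\<And>i. i \<in> I \<Longrightarrow> G n (f i)) \<Longrightarrow> G n (\<Sum>i\<in>I. f i)"
  by (induction I rule: infinite_finite_induct) (auto intro: zero add)

lemma grading_lift_grading: "grading (lift_grading G)"
proof
  fix n m :: int and p q :: "'a poly"
  assume p: "lift_grading G n p" and q: "lift_grading G m q"
  show "lift_grading G (n + m) (p * q)"
    unfolding lift_grading_def coeff_mult
  proof (intro allI sum)
    fix k i :: nat assume "i \<in> {..k}"
    moreover have "G (n - int i + (m - int (k - i))) (coeff p i * coeff q (k - i))"
      using p q by (intro mult) (auto simp: lift_grading_def)
    ultimately show "G (n + m - int k) (coeff p i * coeff q (k - i))"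
      by (simp add: of_nat_diff algebra_simps)
  qed
qed (auto simp: lift_grading_def intro: zero add uminus)

end

text \<open>For \<open>n \<ge> 0\<close>, membership in the \<open>n\<close>-th power of the
  irrelevant ideal.\<close>

definition order_ge :: "int \<Rightarrow> cpoly3 \<Rightarrow> bool" where
  "order_ge n p \<longleftrightarrow> (\<forall>i j k. coeff3 p i j k \<noteq> 0 \<longrightarrow> n \<le> int (i + j + k))"

lemma homogeneous_eq_lift_grading:
  "homogeneous = lift_grading (lift_grading (lift_grading (\<lambda>n c. c \<noteq> 0 \<longrightarrow> n = 0)))"
  unfolding homogeneous_def lift_grading_def coeff3_def
  by (intro ext iffI allI impI) (auto simp: algebra_simps, smt (verit))

lemma order_ge_eq_lift_grading:
  "order_ge = lift_grading (lift_grading (lift_grading (\<lambda>n c. c \<noteq> 0 \<longrightarrow> n \<le> 0)))"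
  unfolding order_ge_def lift_grading_def coeff3_def
  by (intro ext) (auto simp: algebra_simps; smt (verit))

interpretation homogeneous: grading homogeneous
  unfolding homogeneous_eq_lift_grading
  by (intro grading.grading_lift_grading) (unfold_locales, auto)

interpretation order_ge: grading order_ge
  unfolding order_ge_eq_lift_grading
  by (intro grading.grading_lift_grading) (unfold_locales, auto)

lemma coeff3_0 [simp]: "coeff3 0 i j k = 0"
  and coeff3_add [simp]: "coeff3 (p + q) i j k = coeff3 p i j k + coeff3 q i j k"
  and coeff3_diff [simp]: "coeff3 (p - q) i j k = coeff3 p i j k - coeff3 q i j k"
  and coeff3_uminus [simp]: "coeff3 (- p) i j k = - coeff3 p i j k"
  by (simp_all add: coeff3_def)

lemma cpoly3_eqI: "(\<And>i j k. coeff3 p i j k = coeff3 q i j k) \<Longrightarrow> p = q"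
  by (auto simp: coeff3_def intro!: poly_eqI)

definition const3 :: "complex \<Rightarrow> cpoly3" where
  "const3 c = [:[:[:c:]:]:]"

lemma coeff3_const3_mult [simp]: "coeff3 (const3 c * p) i j k = c * coeff3 p i j k"
  by (simp add: coeff3_def const3_def)

lemma coeff3_const3: "coeff3 (const3 c) i j k = (if i = 0 \<and> j = 0 \<and> k = 0 then c else 0)"
  by (auto simp: coeff3_def const3_def coeff_pCons split: nat.splits)

lemma const3_0 [simp]: "const3 0 = 0"
  and const3_1 [simp]: "const3 1 = 1"
  and const3_eq_0_iff [simp]: "const3 c = 0 \<longleftrightarrow> c = 0"
  by (simp_all add: const3_def one_pCons)

lemma const3_mult: "const3 (c * d) = const3 c * const3 d"
  and const3_add: "const3 (c + d) = const3 c + const3 d"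
  and const3_diff: "const3 (c - d) = const3 c - const3 d"
  by (simp_all add: const3_def)

lemma homogeneousD: "homogeneous n p \<Longrightarrow> int (i + j + k) \<noteq> n \<Longrightarrow> coeff3 p i j k = 0"
  by (auto simp: homogeneous_def)

lemma homogeneous_const3 [simp]: "homogeneous 0 (const3 c)"
  by (auto simp: homogeneous_def coeff3_const3)

lemma homogeneous_const3_mult: "homogeneous n p \<Longrightarrow> homogeneous n (const3 c * p)"
  using homogeneous.mult[of 0 "const3 c" n p] by simp

lemma homogeneous_imp_order_ge: "homogeneous n p \<Longrightarrow> order_ge n p"
  by (auto simp: homogeneous_def order_ge_def)

lemma order_ge_0: "order_ge 0 p"
  by (auto simp: order_ge_def)

lemma order_ge_homogeneous_less:
  "order_ge n p \<Longrightarrow> homogeneous m p \<Longrightarrow> m < n \<Longrightarrow> p = 0"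
  by (rule cpoly3_eqI) (force simp: homogeneous_def order_ge_def)

lemma homogeneous_neg: "homogeneous n p \<Longrightarrow> n < 0 \<Longrightarrow> p = 0"
  using order_ge_homogeneous_less[OF order_ge_0] by blast

lemma homogeneous_unique: "homogeneous n p \<Longrightarrow> homogeneous m p \<Longrightarrow> p \<noteq> 0 \<Longrightarrow> n = m"
  using cpoly3_eqI[of p 0] by (fastforce simp: homogeneous_def)

text \<open>Without its constant term, \<open>a\<close> has order at least 1, so its product with
  \<open>p\<close> has order above \<open>n\<close> and contributes nothing in degree
  \<open>n\<close>.\<close>

lemma coeff3_mult_homogeneous:
  assumes "homogeneous n p" "int (i + j + k) = n"
  shows "coeff3 (a * p) i j k = coeff3 a 0 0 0 * coeff3 p i j k"
proof -
  have "order_ge 1 (a - const3 (coeff3 a 0 0 0))"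
    by (force simp: order_ge_def coeff3_const3)
  then have "order_ge (1 + n) ((a - const3 (coeff3 a 0 0 0)) * p)"
    using homogeneous_imp_order_ge[OF assms(1)] by (rule order_ge.mult)
  then have "coeff3 ((a - const3 (coeff3 a 0 0 0)) * p) i j k = 0"
    using assms(2) by (force simp: order_ge_def)
  then show ?thesis
    by (simp add: left_diff_distrib)
qed

section \<open>Homogeneity tested by scaling the variables\<close>

definition scale2 :: "cpoly3 \<Rightarrow> cpoly3" where
  "scale2 p = map_poly (\<lambda>q. map_poly (\<lambda>r. r \<circ>\<^sub>p [:0, 2:]) q \<circ>\<^sub>p [:0, 2:]) p \<circ>\<^sub>p [:0, 2:]"

lemma comm_ring_hom_comp: "comm_ring_hom f \<Longrightarrow> comm_ring_hom g \<Longrightarrow> comm_ring_hom (\<lambda>x. f (g x))"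
  by (simp add: comm_ring_hom_def ring_hom_def semiring_hom_def comm_monoid_add_hom_def
    monoid_add_hom_def zero_hom_def semigroup_add_hom_def plus_hom_def monoid_mult_hom_def
    one_hom_def semigroup_mult_hom_def times_hom_def)

lemma comm_ring_hom_map_poly: "comm_ring_hom f \<Longrightarrow> comm_ring_hom (map_poly f)"
proof -
  assume "comm_ring_hom f"
  then interpret map_poly_comm_ring_hom f
    by (rule map_poly_comm_ring_hom.intro)
  show ?thesis ..
qed

lemma smult_conv_mult_const: "Polynomial.smult c p = [:c:] * p"
  by simp

lemma comm_ring_hom_scale2: "comm_ring_hom scale2"
  unfolding scale2_def [abs_def]
  by (intro comm_ring_hom_comp[OF pcompose_hom.comm_ring_hom_axioms] comm_ring_hom_map_poly
    pcompose_hom.comm_ring_hom_axioms)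

interpretation scale2: comm_ring_hom scale2
  by (rule comm_ring_hom_scale2)

lemma coeff3_scale2: "coeff3 (scale2 p) i j k = 2 ^ (i + j + k) * coeff3 p i j k"
proof -
  have 1: "coeff (2 ^ j * p) i = 2 ^ j * coeff p i" for p :: "complex poly" and i j
    by (metis coeff_smult numeral_poly poly_const_pow smult_conv_mult_const)
  have 2: "coeff (coeff (2 ^ k * p) j) i = 2 ^ k * coeff (coeff p j) i"
    for p :: "complex poly poly" and i j k
    by (metis 1 coeff_smult numeral_poly poly_const_pow smult_conv_mult_const)
  have "coeff (coeff (coeff (scale2 p) k) j) i =
      2 ^ k * coeff (coeff (map_poly (\<lambda>r. r \<circ>\<^sub>p [:0, 2:]) (coeff p k) \<circ>\<^sub>p [:0, 2:]) j) i"
    unfolding scale2_def by (subst coeff_pcompose_linear, subst 2, subst coeff_map_poly) auto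
  also have "\<dots> = 2 ^ k * (2 ^ j * (2 ^ i * coeff (coeff (coeff p k) j) i))"
    by (subst coeff_pcompose_linear, subst 1, subst coeff_map_poly) (auto simp: coeff_pcompose_linear)
  finally show ?thesis
    by (simp only: coeff3_def power_add mult_ac)
qed

text \<open>\<open>scale2\<close> doubles each variable and thus multiplies a monomial of degree
  \<open>n\<close> by \<open>2 ^ n\<close>. These factors are pairwise distinct, which is checked on
  norms, in the reals.\<close>

lemma homogeneous_iff_scale2:
  "homogeneous (int n) p \<longleftrightarrow> scale2 p = const3 (2 ^ n) * p"
proof
  assume p: "homogeneous (int n) p"
  show "scale2 p = const3 (2 ^ n) * p"
  proof (rule cpoly3_eqI)
    fix i j k
    show "coeff3 (scale2 p) i j k = coeff3 (const3 (2 ^ n) * p) i j k"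
      using homogeneousD[OF p, of i j k]
      by (cases "i + j + k = n") (auto simp: coeff3_scale2)
  qed
next
  assume *: "scale2 p = const3 (2 ^ n) * p"
  show "homogeneous (int n) p"
    unfolding homogeneous_def
  proof (intro allI impI)
    fix i j k assume "coeff3 p i j k \<noteq> 0"
    then have "(2 :: complex) ^ (i + j + k) = 2 ^ n"
      using arg_cong[OF *, of "\<lambda>p. coeff3 p i j k"] by (simp add: coeff3_scale2)
    then have "norm ((2 :: complex) ^ (i + j + k)) = norm ((2 :: complex) ^ n)"
      by simp
    then have "(2 :: real) ^ (i + j + k) = 2 ^ n"
      by (simp only: norm_power norm_numeral)
    then show "int (i + j + k) = int n"
      by (subst (asm) power_inject_exp) auto
  qed
qed

text \<open>\<open>scale2\<close> is a ring homomorphism, so \<open>p\<close> cancels from the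
  scaling equation of \<open>p * q\<close>. Powers of 2 are kept on both sides, so that
  \<open>m < n\<close> is no special case.\<close>

lemma homogeneous_mult_cancel:
  assumes "homogeneous n p" "homogeneous m (p * q)" "p \<noteq> 0"
  shows "homogeneous (m - n) q"
proof (cases "q = 0")
  case True
  then show ?thesis by (simp add: homogeneous.zero)
next
  case False
  obtain n' m' where n': "n = int n'" and m': "m = int m'"
    using homogeneous_neg[OF assms(1)] homogeneous_neg[OF assms(2)] assms(3) False
    by (metis int_nat_eq mult_eq_0_iff not_le)
  have "const3 (2 ^ m') * (p * q) = const3 (2 ^ n') * p * scale2 q"
    using assms(1,2) unfolding n' m' homogeneous_iff_scale2 by (metis scale2.hom_mult)
  then have "p * (const3 (2 ^ m') * q) = p * (const3 (2 ^ n') * scale2 q)"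
    by (simp only: mult_ac)
  then have *: "const3 (2 ^ m') * q = const3 (2 ^ n') * scale2 q"
    using assms(3) by (simp only: mult_left_cancel not_False_eq_True)
  have "n' + (i + j + k) = m'" if "coeff3 q i j k \<noteq> 0" for i j k
  proof -
    have "(2 :: complex) ^ m' = 2 ^ (n' + (i + j + k))"
      using arg_cong[OF *, of "\<lambda>p. coeff3 p i j k"] that
      unfolding coeff3_const3_mult coeff3_scale2 power_add by (metis mult.assoc mult_right_cancel)
    then have "norm ((2 :: complex) ^ m') = norm ((2 :: complex) ^ (n' + (i + j + k)))"
      by simp
    then have "(2 :: real) ^ m' = 2 ^ (n' + (i + j + k))"
      by (simp only: norm_power norm_numeral)
    then show ?thesis
      by (subst (asm) power_inject_exp) auto
  qed
  then show ?thesis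
    by (force simp: homogeneous_def n' m')
qed

subsection \<open>Specialising a variable\<close>

text \<open>Setting the variable \<open>x\<close> to a constant leaves a polynomial in \<open>y\<close> (inner) and \<open>z\<close> (outer).\<close>

definition eval_x :: "complex \<Rightarrow> cpoly3 \<Rightarrow> complex poly poly" where
  "eval_x a = map_poly (map_poly (\<lambda>p. poly p a))"

lemma comm_ring_hom_eval_x: "comm_ring_hom (eval_x a)"
  unfolding eval_x_def by (intro comm_ring_hom_map_poly poly_hom.comm_ring_hom_axioms)

interpretation eval_x: comm_ring_hom "eval_x a"
  by (rule comm_ring_hom_eval_x)

lemma coeff_eval_x: "coeff (coeff (eval_x a p) k) j = poly (coeff (coeff p k) j) a"
  by (simp add: eval_x_def coeff_map_poly)

lemma poly_map_poly_eval:
  fixes p :: "'a::comm_ring_1 poly poly"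
  shows "poly (map_poly (\<lambda>r. poly r a) p) b = poly (poly p [:b:]) a"
  using poly_hom.poly_map_poly[of a p "[:b:]"] by simp

lemma map_poly_pCons_const: "map_poly (\<lambda>r :: complex poly. poly r a) [:[:c:]:] = [:c:]"
  by (rule poly_eqI) (simp add: coeff_map_poly coeff_pCons split: nat.split)

lemma poly_eval_x: "poly (poly (eval_x a p) [:c:]) b = eval3 p a b c"
proof -
  interpret h: comm_ring_hom "map_poly (\<lambda>p :: complex poly. poly p a)"
    by (intro comm_ring_hom_map_poly poly_hom.comm_ring_hom_axioms)
  have "poly (eval_x a p) [:c:] = map_poly (\<lambda>p. poly p a) (poly p [:[:c:]:])"
    using h.poly_map_poly[of p "[:[:c:]:]"]
    by (simp only: eval_x_def map_poly_pCons_const)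
  then show ?thesis
    by (simp add: poly_map_poly_eval eval3_def)
qed

interpretation eval3: comm_ring_hom "\<lambda>p. eval3 p a b c"
  unfolding eval3_def
  by (rule comm_ring_hom_comp[OF poly_hom.comm_ring_hom_axioms
      comm_ring_hom_comp[OF poly_hom.comm_ring_hom_axioms poly_hom.comm_ring_hom_axioms]])

text \<open>The leading coefficient of a common factor \<open>h\<close> divides that of
  \<open>p\<close>, so it is a nonzero constant. Setting the inner variable to \<open>b\<close> then
  keeps the degree of \<open>h\<close>, and a nonconstant \<open>h\<close> would have a zero on that
  line.\<close>

lemma coprime_if_no_common_root:
  fixes p q :: "complex poly poly"
  assumes lead: "is_unit (lead_coeff p)"
    and no_root: "\<And>c. \<not> (poly (poly p [:c:]) b = 0 \<and> poly (poly q [:c:]) b = 0)"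
  shows "coprime p q"
proof (rule coprimeI)
  fix h assume "h dvd p" "h dvd q"
  then obtain k where k: "p = h * k" by blast
  then have "is_unit (lead_coeff h)"
    using lead dvd_mult_left unfolding k lead_coeff_mult by blast
  then obtain c where c: "lead_coeff h = [:c:]" "is_unit c"
    using is_unit_poly_iff[THEN iffD1] by blast
  show "is_unit h"
  proof (cases "degree h = 0")
    case True
    then show ?thesis
      using \<open>is_unit (lead_coeff h)\<close> by (metis is_unit_poly_iff degree_eq_zeroE lead_coeff_pCons(2))
  next
    case False
    define r where "r = map_poly (\<lambda>r. poly r b) h"
    have "coeff r (degree h) \<noteq> 0"
      using c by (auto simp: r_def coeff_map_poly)
    then have "degree r \<noteq> 0"
      using False le_degree[of r "degree h"] by auto
    then obtain z where "poly r z = 0"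
      using fundamental_theorem_of_algebra[of r] by (auto simp: constant_degree)
    then have "poly (poly h [:z:]) b = 0"
      by (simp add: r_def poly_map_poly_eval)
    then show ?thesis
      using no_root[of z] \<open>h dvd p\<close> \<open>h dvd q\<close> by (auto elim!: dvdE)
  qed
qed

subsection \<open>The Nullstellensatz in the affine plane\<close>

text \<open>Elimination of the outer variable. Pseudo-division by an element \<open>g\<close> of
  least degree in the ideal leaves no remainder, so the primitive part of \<open>g\<close> divides
  both \<open>p\<close> and \<open>q\<close> and is a unit by coprimality.\<close>

lemma coprime_imp_const_in_ideal:
  fixes p q :: "complex poly poly"
  assumes "coprime p q" "p \<noteq> 0"
  shows "\<exists>u v d. d \<noteq> 0 \<and> [:d:] = u * p + v * q"
proof -
  define I where "I = {g. \<exists>u v. g = u * p + v * q}"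
  have diffI: "g - h \<in> I" if gh: "g \<in> I" "h \<in> I" for g h
  proof -
    obtain u v u' v' where "g = u * p + v * q" "h = u' * p + v' * q"
      using gh by (auto simp: I_def)
    then have "g - h = (u - u') * p + (v - v') * q"
      by (simp add: algebra_simps)
    then show ?thesis unfolding I_def by blast
  qed
  have multI: "r * g \<in> I" if g: "g \<in> I" for g r
  proof -
    obtain u v where "g = u * p + v * q"
      using g by (auto simp: I_def)
    then have "r * g = (r * u) * p + (r * v) * q"
      by (simp add: algebra_simps)
    then show ?thesis unfolding I_def by blast
  qed
  have "p = 1 * p + 0 * q" "q = 0 * p + 1 * q"
    by auto
  then have "p \<in> I" "q \<in> I"
    unfolding I_def by blast+
  then obtain g where g: "g \<in> I" "g \<noteq> 0" and min: "\<And>h. h \<in> I \<Longrightarrow> h \<noteq> 0 \<Longrightarrow> degree g \<le> degree h"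
    using ex_has_least_nat[of "\<lambda>g. g \<in> I \<and> g \<noteq> 0" p degree] \<open>p \<noteq> 0\<close> by blast
  define h where "h = primitive_part g"
  have "h dvd f" if f: "f \<in> I" for f
  proof -
    obtain a k where a: "a \<noteq> 0" "Polynomial.smult a f = g * k + pseudo_mod f g"
      using pseudo_mod(1)[OF g(2)] by blast
    have "pseudo_mod f g = [:a:] * f - k * g"
      using a(2) by (simp add: algebra_simps)
    then have "pseudo_mod f g \<in> I"
      using f g(1) multI diffI by metis
    then have "pseudo_mod f g = 0"
      using pseudo_mod(2)[OF g(2), of f] min by fastforce
    then have "Polynomial.smult a f = h * (Polynomial.smult (content g) k)"
      using a(2) content_times_primitive_part[of g] by (metis add_0_right h_def mult_smult_left mult_smult_right)
    then have "h dvd Polynomial.smult a f"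
      by (rule dvdI)
    \<comment> \<open>Gauss's lemma: over the fraction field the scalar \<open>a\<close> is a unit,
      and divisibility by the primitive \<open>h\<close> descends.\<close>
    then have "fract_poly h dvd Polynomial.smult (to_fract a) (fract_poly f)"
      by (metis fract_poly_dvd fract_poly_smult)
    then have "fract_poly h dvd fract_poly f"
      using a(1) by (simp add: dvd_smult_iff)
    then show ?thesis
      using g(2) by (intro fract_poly_dvdD) (auto simp: h_def)
  qed
  then have "is_unit h"
    using \<open>p \<in> I\<close> \<open>q \<in> I\<close> assms(1) coprime_common_divisor by blast
  then have "degree g = 0"
    using degree_primitive_part[of g] by (metis degree_pCons_0 h_def is_unit_poly_iff)
  then obtain d where "g = [:d:]"
    by (auto elim: degree_eq_zeroE)
  then show ?thesis
    using g unfolding I_def by auto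
qed

text \<open>Let \<open>y\<close> be the inner variable. On each line \<open>y = b\<close>, Bezout in
  one variable gives an element of the ideal that is 1 modulo \<open>y - b\<close>, so
  \<open>y - b\<close> is invertible modulo the ideal. Elimination puts a nonzero polynomial in
  \<open>y\<close> into the ideal; its linear factors are cancelled one at a time until a nonzero
  constant remains.\<close>

lemma weak_nullstellensatz_2:
  fixes p q w :: "complex poly poly"
  assumes "coprime p q" "p \<noteq> 0"
    and no_root: "\<And>b c. \<not> (poly (poly p [:c:]) b = 0 \<and> poly (poly q [:c:]) b = 0 \<and> poly (poly w [:c:]) b = 0)"
  shows "\<exists>u v t. u * p + v * q + t * w = 1"
proof -
  define I where "I = {g. \<exists>u v t. g = u * p + v * q + t * w}"
  have addI: "g + h \<in> I" if gh: "g \<in> I" "h \<in> I" for g h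
  proof -
    obtain u v t u' v' t' where "g = u * p + v * q + t * w" "h = u' * p + v' * q + t' * w"
      using gh by (auto simp: I_def)
    then have "g + h = (u + u') * p + (v + v') * q + (t + t') * w"
      by (simp add: algebra_simps)
    then show ?thesis unfolding I_def by blast
  qed
  have multI: "r * g \<in> I" if g: "g \<in> I" for g r
  proof -
    obtain u v t where "g = u * p + v * q + t * w"
      using g by (auto simp: I_def)
    then have "r * g = (r * u) * p + (r * v) * q + (r * t) * w"
      by (simp add: algebra_simps)
    then show ?thesis unfolding I_def by blast
  qed
  have local_unit: "\<exists>t. 1 - [:[:-b, 1:]:] * t \<in> I" for b
  proof -
    define ev where "ev = map_poly (\<lambda>r :: complex poly. poly r b)"
    interpret ev: comm_ring_hom ev
      unfolding ev_def by (intro comm_ring_hom_map_poly poly_hom.comm_ring_hom_axioms)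
    define g where "g = gcd (gcd (ev p) (ev q)) (ev w)"
    have no_root_g: "poly g c \<noteq> 0" for c
    proof
      assume "poly g c = 0"
      then have "[:-c, 1:] dvd g"
        by (simp add: poly_eq_0_iff_dvd)
      then have "[:-c, 1:] dvd ev p" "[:-c, 1:] dvd ev q" "[:-c, 1:] dvd ev w"
        unfolding g_def by auto
      then show False
        using no_root[of c b] unfolding ev_def poly_eq_0_iff_dvd[symmetric]
        by (simp add: poly_map_poly_eval)
    qed
    then have "degree g = 0"
      using fundamental_theorem_of_algebra[of g] by (auto simp: constant_degree)
    then obtain e where e: "g = [:e:]" "e \<noteq> 0"
      using no_root_g[of 0] by (auto elim: degree_eq_zeroE)
    obtain u v where uv: "u * ev p + v * ev q = gcd (ev p) (ev q)"
      using bezout_coefficients_fst_snd by blast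
    obtain u' v' where "u' * gcd (ev p) (ev q) + v' * ev w = g"
      unfolding g_def using bezout_coefficients_fst_snd by blast
    then have "[:inverse e:] * (u' * (u * ev p + v * ev q) + v' * ev w) = 1"
      using e uv by (simp add: one_pCons)
    then have *: "([:inverse e:] * u' * u) * ev p + ([:inverse e:] * u' * v) * ev q + ([:inverse e:] * v') * ev w = 1"
      by (simp only: algebra_simps)
    \<comment> \<open>\<open>L\<close> regards a polynomial in the outer variable as one with
      constant coefficients. It is a section of \<open>ev\<close> and lifts the Bezout
      coefficients.\<close>
    define L :: "complex poly \<Rightarrow> complex poly poly" where "L = map_poly (\<lambda>c. [:c:])"
    have ev_L: "ev (L f) = f" for f
      by (rule poly_eqI) (simp add: ev_def L_def coeff_map_poly)
    define h where "h = L ([:inverse e:] * u' * u) * p + L ([:inverse e:] * u' * v) * q + L ([:inverse e:] * v') * w"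
    have "h \<in> I"
      unfolding h_def I_def by blast
    have "ev (1 - h) = 0"
      unfolding h_def ev.hom_minus ev.hom_add ev.hom_mult ev_L * by simp
    then have "[:-b, 1:] dvd coeff (1 - h) k" for k
      unfolding poly_eq_0_iff_dvd[symmetric] ev_def
      by (metis coeff_0 coeff_map_poly poly_0)
    then have "[:[:-b, 1:]:] dvd 1 - h"
      by (simp add: const_poly_dvd_iff)
    then obtain t where "1 - h = [:[:-b, 1:]:] * t" ..
    then have "1 - [:[:-b, 1:]:] * t = h"
      by (metis diff_diff_eq2 add_diff_cancel_left')
    then show ?thesis
      using \<open>h \<in> I\<close> by metis
  qed
  have "1 \<in> I" if "d \<noteq> 0" "[:d:] \<in> I" for d
    using that
  proof (induction "degree d" arbitrary: d rule: less_induct)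
    case less
    show ?case
    proof (cases "degree d = 0")
      case True
      then obtain e where e: "d = [:e:]" "e \<noteq> 0"
        using less.prems by (auto elim: degree_eq_zeroE)
      then have "1 = [:[:inverse e:]:] * [:d:]"
        by (simp add: one_pCons)
      then show ?thesis
        using multI[OF less.prems(2)] by metis
    next
      case False
      then obtain b where "poly d b = 0"
        using fundamental_theorem_of_algebra[of d] by (auto simp: constant_degree)
      then obtain d' where d': "d = [:-b, 1:] * d'"
        by (auto simp: poly_eq_0_iff_dvd)
      then have "d' \<noteq> 0"
        using less.prems(1) by auto
      then have "degree d' < degree d"
        unfolding d' by (subst degree_mult_eq) auto
      obtain t where t: "1 - [:[:-b, 1:]:] * t \<in> I"
        using local_unit by blast
      have "[:d:] = [:d':] * [:[:-b, 1:]:]"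
        unfolding d' by simp
      then have "[:d':] = [:d':] * (1 - [:[:-b, 1:]:] * t) + t * [:d:]"
        by (simp only: algebra_simps) simp
      then have "[:d':] \<in> I"
        using addI[OF multI[OF t] multI[OF less.prems(2)]] by metis
      then show ?thesis
        using less.hyps[of d'] \<open>degree d' < degree d\<close> \<open>d' \<noteq> 0\<close> by blast
    qed
  qed
  moreover obtain u v d where "d \<noteq> 0" "[:d:] = u * p + v * q"
    using coprime_imp_const_in_ideal[OF assms(1,2)] by blast
  moreover have "u * p + v * q = u * p + v * q + 0 * w"
    by simp
  ultimately have "1 \<in> I"
    unfolding I_def by (metis (mono_tags, lifting) mem_Collect_eq)
  then show ?thesis
    unfolding I_def by auto
qed

subsection \<open>Homogenization\<close>

definition X :: cpoly3 where "X = [:[:[:0, 1:]:]:]"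
definition Y :: cpoly3 where "Y = [:[:0, 1:]:]"
definition Z :: cpoly3 where "Z = [:0, 1:]"

lemma homogeneous_X: "homogeneous 1 X" and homogeneous_Y: "homogeneous 1 Y" and homogeneous_Z: "homogeneous 1 Z"
  by (auto simp: homogeneous_def coeff3_def X_def Y_def Z_def coeff_pCons split: nat.splits)

lemma homogeneous_power: "homogeneous 1 p \<Longrightarrow> homogeneous (int n) (p ^ n)"
proof (induction n)
  case 0
  show ?case using homogeneous_const3[of 1] by simp
next
  case (Suc n)
  then show ?case using homogeneous.mult[of 1 p "int n" "p ^ n"] by (simp add: add.commute)
qed

lemma eval_x_X: "eval_x a X = [:[:a:]:]" and eval_x_Y: "eval_x a Y = [:[:0, 1:]:]"
  and eval_x_Z: "eval_x a Z = [:0, 1:]" and eval_x_const3: "eval_x a (const3 c) = [:[:c:]:]"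
  by (auto intro!: poly_eqI simp: coeff_eval_x X_def Y_def Z_def const3_def coeff_pCons split: nat.splits)

lemma eval_x_eq_0_imp_X_dvd: "eval_x 0 p = 0 \<Longrightarrow> X dvd p"
  unfolding X_def const_poly_dvd_iff
  by (metis coeff_0 coeff_eval_x poly_eq_0_iff_dvd minus_zero)

lemma prime_elem_X: "prime_elem X"
proof -
  have "X dvd p \<longleftrightarrow> eval_x 0 p = 0" for p
    using eval_x_eq_0_imp_X_dvd by (auto simp: eval_x.hom_mult eval_x_X elim!: dvdE)
  moreover have "X \<noteq> 0" "eval_x 0 1 = 1"
    by (simp_all add: X_def)
  ultimately show ?thesis
    unfolding prime_elem_def by (auto simp: eval_x.hom_mult)
qed

text \<open>In a form, the exponents of \<open>y\<close> and \<open>z\<close> determine that of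
  \<open>x\<close>. Each coefficient is therefore a monomial in \<open>x\<close>, recovered from its
  value at 1.\<close>

lemma eval_x_1_eq_0_imp_eq_0:
  assumes "homogeneous n p" "eval_x 1 p = 0"
  shows "p = 0"
proof -
  have "coeff (coeff p k) j = 0" for j k
  proof -
    define r where "r = coeff (coeff p k) j"
    have "r = monom (lead_coeff r) (degree r)"
    proof (rule poly_eqI)
      fix i
      have "coeff r i \<noteq> 0 \<Longrightarrow> lead_coeff r \<noteq> 0 \<Longrightarrow> i = degree r"
        using homogeneousD[OF assms(1), of i j k] homogeneousD[OF assms(1), of "degree r" j k]
        unfolding coeff3_def r_def by force
      then show "coeff r i = coeff (monom (lead_coeff r) (degree r)) i"
        by (cases "r = 0") auto
    qed
    then have "poly r 1 = lead_coeff r"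
      by (metis mult.right_neutral poly_monom power_one)
    moreover have "poly r 1 = 0"
      unfolding r_def coeff_eval_x[symmetric] assms(2) by simp
    ultimately show ?thesis
      unfolding r_def by simp
  qed
  then show ?thesis
    by (intro poly_eqI) simp
qed

text \<open>All large degrees are provided, so that several polynomials can be homogenised in a
  common degree.\<close>

lemma homogenization_ex_const:
  "\<exists>N0. \<forall>N\<ge>N0. \<exists>p. homogeneous (int N) p \<and> eval_x 1 p = [:r:]"
proof (induction r)
  case 0
  show ?case by (intro exI[of _ 0] allI impI) (auto simp: homogeneous.zero)
next
  case (pCons a r)
  then obtain N0 where N0: "\<And>N. N \<ge> N0 \<Longrightarrow> \<exists>p. homogeneous (int N) p \<and> eval_x 1 p = [:r:]"
    by blast
  have "\<exists>p. homogeneous (int N) p \<and> eval_x 1 p = [:pCons a r:]" if N: "N \<ge> Suc N0" for N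
  proof -
    obtain M where M: "N = Suc M" "M \<ge> N0"
      using N by (cases N) auto
    obtain p where p: "homogeneous (int M) p" "eval_x 1 p = [:r:]"
      using N0[OF M(2)] by blast
    have "homogeneous (int N) (const3 a * X ^ N + Y * p)"
      using homogeneous.mult[OF homogeneous_Y p(1)] M(1)
      by (intro homogeneous.add homogeneous_const3_mult homogeneous_power homogeneous_X) simp
    moreover have "eval_x 1 (const3 a * X ^ N + Y * p) = [:pCons a r:]"
      by (simp add: eval_x.hom_mult eval_x.hom_add eval_x.hom_power eval_x_X eval_x_Y eval_x_const3 p(2)
        flip: one_pCons)
    ultimately show ?thesis by blast
  qed
  then show ?case by blast
qed

lemma homogenization_ex:
  "\<exists>N0. \<forall>N\<ge>N0. \<exists>p. homogeneous (int N) p \<and> eval_x 1 p = h"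
proof (induction h)
  case 0
  show ?case by (intro exI[of _ 0] allI impI) (auto simp: homogeneous.zero)
next
  case (pCons r h)
  then obtain N0 where N0: "\<And>N. N \<ge> N0 \<Longrightarrow> \<exists>p. homogeneous (int N) p \<and> eval_x 1 p = h"
    by blast
  obtain N1 where N1: "\<And>N. N \<ge> N1 \<Longrightarrow> \<exists>p. homogeneous (int N) p \<and> eval_x 1 p = [:r:]"
    using homogenization_ex_const by blast
  have "\<exists>p. homogeneous (int N) p \<and> eval_x 1 p = pCons r h" if N: "N \<ge> Suc (max N0 N1)" for N
  proof -
    obtain M where M: "N = Suc M" "M \<ge> N0"
      using N by (cases N) auto
    obtain p where p: "homogeneous (int M) p" "eval_x 1 p = h"
      using N0[OF M(2)] by blast
    obtain p' where p': "homogeneous (int N) p'" "eval_x 1 p' = [:r:]"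
      using N1[of N] N by (meson Suc_le_eq less_imp_le max.strict_boundedE)
    have "homogeneous (int N) (p' + Z * p)"
      using homogeneous.mult[OF homogeneous_Z p(1)] M(1)
      by (intro homogeneous.add p') simp
    moreover have "eval_x 1 (p' + Z * p) = pCons r h"
      by (simp add: eval_x.hom_mult eval_x.hom_add eval_x_Z p p')
    ultimately show ?thesis by blast
  qed
  then show ?case by blast
qed


subsection \<open>Three forms without common zero\<close>

definition no_common_zero :: "cpoly3 \<Rightarrow> cpoly3 \<Rightarrow> cpoly3 \<Rightarrow> bool" where
  "no_common_zero p q w \<longleftrightarrow>
     (\<forall>a b c. eval3 p a b c = 0 \<and> eval3 q a b c = 0 \<and> eval3 w a b c = 0 \<longrightarrow> a = 0 \<and> b = 0 \<and> c = 0)"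

lemma eval3_const3 [simp]: "eval3 (const3 c) x y z = c"
  by (simp add: eval3_def const3_def)

lemma eval3_X: "eval3 X a b c = a"
  by (simp add: eval3_def X_def)

lemma coeff3_00n:
  assumes "homogeneous (int n) p"
  shows "coeff3 p 0 0 n = eval3 p 0 0 1"
proof -
  define r where "r = map_poly (\<lambda>r. poly r 0) (eval_x 0 p)"
  have "coeff r k = coeff3 p 0 0 k" for k
    by (simp add: r_def coeff_map_poly coeff_eval_x coeff3_def poly_0_coeff_0)
  then have "r = monom (coeff3 p 0 0 n) n"
    using homogeneousD[OF assms, of 0 0] by (intro poly_eqI) auto
  then have "poly r 1 = coeff3 p 0 0 n"
    by (simp add: poly_monom)
  then show ?thesis
    unfolding r_def poly_map_poly_eval poly_eval_x by simp
qed

text \<open>The only monomial of degree \<open>n\<close> divisible by \<open>z^n\<close> is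
  \<open>z^n\<close> itself, so the top coefficient in \<open>z\<close> does not depend on
  \<open>a\<close>.\<close>

lemma coeff_eval_x_top:
  assumes "homogeneous (int n) p"
  shows "coeff (eval_x a p) n = [:eval3 p 0 0 1:]"
    and "degree (eval_x a p) \<le> n"
proof -
  have "coeff (coeff p n) j = (if j = 0 then [:eval3 p 0 0 1:] else 0)" for j
    using homogeneousD[OF assms, of _ j n] coeff3_00n[OF assms]
    by (intro poly_eqI) (auto simp: coeff3_def coeff_pCons split: nat.split)
  then show "coeff (eval_x a p) n = [:eval3 p 0 0 1:]"
    by (intro poly_eqI) (auto simp: coeff_eval_x coeff_pCons split: nat.split)
  show "degree (eval_x a p) \<le> n"
  proof (intro degree_le allI impI)
    fix k assume "n < k"
    then have "coeff (coeff p k) j = 0" for j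
      using homogeneousD[OF assms, of _ j k] by (intro poly_eqI) (auto simp: coeff3_def)
    then show "coeff (eval_x a p) k = 0"
      by (intro poly_eqI) (auto simp: coeff_eval_x)
  qed
qed

lemma degree_eval_x:
  assumes "homogeneous (int n) p" "eval3 p 0 0 1 \<noteq> 0"
  shows "degree (eval_x a p) = n"
  using coeff_eval_x_top[OF assms(1), of a] assms(2)
  by (intro antisym le_degree) auto

lemma is_unit_lead_coeff_eval_x:
  assumes "homogeneous (int n) p" "eval3 p 0 0 1 \<noteq> 0"
  shows "is_unit (lead_coeff (eval_x a p))"
  unfolding degree_eval_x[OF assms] coeff_eval_x_top(1)[OF assms(1)]
  using assms(2) by (simp add: is_unit_const_poly_iff)

lemma finite_roots_eval3:
  assumes "homogeneous (int n) p" "eval3 p 0 0 1 \<noteq> 0"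
  shows "finite {c. eval3 p a b c = 0}"
proof -
  define r where "r = map_poly (\<lambda>r. poly r b) (eval_x a p)"
  have "coeff r n \<noteq> 0"
    using coeff_eval_x_top(1)[OF assms(1)] assms(2) by (simp add: r_def coeff_map_poly)
  then have "finite {c. poly r c = 0}"
    by (intro poly_roots_finite) auto
  then show ?thesis
    by (simp add: r_def poly_map_poly_eval poly_eval_x)
qed

text \<open>
  For all but finitely many \<open>s\<close>, the curves \<open>p = 0\<close> and \<open>q + s w = 0\<close> have no common point on the
  lines joining \<open>(0 : 0 : 1)\<close> to \<open>(0 : 1 : 0)\<close> and to \<open>(1 : 0 : 0)\<close>.
\<close>

lemma ex_coprime_combination:
  assumes p: "homogeneous (int n) p" "eval3 p 0 0 1 \<noteq> 0" and "no_common_zero p q w"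
  shows "\<exists>s. coprime (eval_x 0 p) (eval_x 0 (q + const3 s * w)) \<and>
             coprime (eval_x 1 p) (eval_x 1 (q + const3 s * w))"
proof -
  \<comment> \<open>The values of \<open>s\<close> for which \<open>q + s w\<close> vanishes at a
    zero of \<open>p\<close> of the form \<open>(0, 1, c)\<close> or \<open>(1, 0, c)\<close>. If
    \<open>w\<close> vanishes there, \<open>q\<close> does not and no \<open>s\<close> is bad; the
    value 0 from division by zero is then excluded harmlessly.\<close>
  define U where "U = (\<lambda>c. - eval3 q 0 1 c / eval3 w 0 1 c) ` {c. eval3 p 0 1 c = 0} \<union>
    (\<lambda>c. - eval3 q 1 0 c / eval3 w 1 0 c) ` {c. eval3 p 1 0 c = 0}"
  have "finite U"
    unfolding U_def using finite_roots_eval3[OF p] by auto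
  then obtain s where s: "s \<notin> U"
    using ex_new_if_finite[OF infinite_UNIV_char_0] by blast
  have root: "s = - eval3 q a b c / eval3 w a b c"
    if "eval3 p a b c = 0" "eval3 (q + const3 s * w) a b c = 0" "a \<noteq> 0 \<or> b \<noteq> 0" for a b c
  proof -
    have *: "eval3 q a b c + s * eval3 w a b c = 0"
      using that(2) by (simp add: eval3.hom_add eval3.hom_mult)
    have "eval3 w a b c \<noteq> 0"
    proof
      assume "eval3 w a b c = 0"
      moreover from this have "eval3 q a b c = 0"
        using * by simp
      ultimately show False
        using \<open>no_common_zero p q w\<close> that(1,3) unfolding no_common_zero_def by blast
    qed
    moreover have "s * eval3 w a b c = - eval3 q a b c"
      using * by (metis add.commute eq_neg_iff_add_eq_0)
    ultimately show ?thesis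
      by (simp only: eq_divide_eq) simp
  qed
  have "coprime (eval_x 0 p) (eval_x 0 (q + const3 s * w))"
    using root[of 0 1] s is_unit_lead_coeff_eval_x[OF p, of 0]
    by (intro coprime_if_no_common_root[where b = 1]) (auto simp: poly_eval_x U_def)
  moreover have "coprime (eval_x 1 p) (eval_x 1 (q + const3 s * w))"
    using root[of 1 0] s is_unit_lead_coeff_eval_x[OF p, of 1]
    by (intro coprime_if_no_common_root[where b = 0]) (auto simp: poly_eval_x U_def)
  ultimately show ?thesis
    by blast
qed

text \<open>In the chart \<open>x = 1\<close> the ideal contains 1. Once the coefficients are
  homogenised to a common degree, the difference of the two sides is a form that vanishes at
  \<open>x = 1\<close>, hence 0.\<close>

lemma X_power_in_ideal:
  assumes "homogeneous (int n) p" "homogeneous (int n) q" "homogeneous (int n) w"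
    and "no_common_zero p q w" "coprime (eval_x 1 p) (eval_x 1 q)" "p \<noteq> 0"
  shows "\<exists>N u v t. X ^ N = u * p + v * q + t * w"
proof -
  have "eval_x 1 p \<noteq> 0"
    using eval_x_1_eq_0_imp_eq_0 assms(1,6) by blast
  moreover have "\<not> (poly (poly (eval_x 1 p) [:c:]) b = 0 \<and> poly (poly (eval_x 1 q) [:c:]) b = 0 \<and>
      poly (poly (eval_x 1 w) [:c:]) b = 0)" for b c
    using assms(4) unfolding poly_eval_x no_common_zero_def by (metis zero_neq_one)
  ultimately obtain u v t where uvt: "u * eval_x 1 p + v * eval_x 1 q + t * eval_x 1 w = 1"
    using weak_nullstellensatz_2[OF assms(5)] by blast
  obtain Nu Nv Nt where N:
    "\<And>N. N \<ge> Nu \<Longrightarrow> \<exists>p. homogeneous (int N) p \<and> eval_x 1 p = u"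
    "\<And>N. N \<ge> Nv \<Longrightarrow> \<exists>p. homogeneous (int N) p \<and> eval_x 1 p = v"
    "\<And>N. N \<ge> Nt \<Longrightarrow> \<exists>p. homogeneous (int N) p \<and> eval_x 1 p = t"
    using homogenization_ex[of u] homogenization_ex[of v] homogenization_ex[of t] by blast
  define N where "N = Nu + Nv + Nt"
  obtain u' v' t' where uvt': "homogeneous (int N) u'" "homogeneous (int N) v'" "homogeneous (int N) t'"
      "eval_x 1 u' = u" "eval_x 1 v' = v" "eval_x 1 t' = t"
    using N(1)[of N] N(2)[of N] N(3)[of N] by (auto simp: N_def)
  have "homogeneous (int (N + n)) (X ^ (N + n) - (u' * p + v' * q + t' * w))"
    using homogeneous.mult[OF uvt'(1) assms(1)] homogeneous.mult[OF uvt'(2) assms(2)]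
      homogeneous.mult[OF uvt'(3) assms(3)]
    by (intro homogeneous.diff homogeneous.add homogeneous_power homogeneous_X) simp_all
  moreover have "eval_x 1 (X ^ (N + n) - (u' * p + v' * q + t' * w)) = 0"
    using uvt uvt'(4-6)
    by (simp add: eval_x.hom_mult eval_x.hom_add eval_x.hom_minus eval_x.hom_power eval_x_X flip: one_pCons)
  ultimately have "X ^ (N + n) = u' * p + v' * q + t' * w"
    using eval_x_1_eq_0_imp_eq_0 by fastforce
  then show ?thesis by blast
qed

section \<open>Cancelling \<open>X\<close> modulo two forms\<close>

definition lift_x :: "complex poly poly \<Rightarrow> cpoly3" where
  "lift_x = map_poly (map_poly (\<lambda>c. [:c:]))"

lemma eval_x_lift_x: "eval_x a (lift_x h) = h"
  by (intro poly_eqI) (simp add: coeff_eval_x lift_x_def coeff_map_poly)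

text \<open>At \<open>x = 0\<close> the relation becomes a syzygy of two coprime polynomials, hence
  \<open>h\<close> times the Koszul syzygy. Subtracting its lift from \<open>(u, v)\<close> leaves
  coefficients divisible by \<open>X\<close>.\<close>

lemma X_cancel_ideal:
  assumes "coprime (eval_x 0 p) (eval_x 0 q)" "eval_x 0 p \<noteq> 0" "X * f = u * p + v * q"
  shows "\<exists>u v. f = u * p + v * q"
proof -
  have *: "eval_x 0 u * eval_x 0 p + eval_x 0 v * eval_x 0 q = 0"
    using arg_cong[OF assms(3), of "eval_x 0"]
    by (simp add: eval_x.hom_mult eval_x.hom_add eval_x_X)
  then have "eval_x 0 p dvd eval_x 0 v * eval_x 0 q"
    by (metis dvd_0_right dvd_add_right_iff dvd_triv_right)
  then obtain h where h: "eval_x 0 v = eval_x 0 p * h"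
    using assms(1) by (metis coprime_dvd_mult_left_iff dvdE)
  then have "eval_x 0 p * (eval_x 0 u + h * eval_x 0 q) = 0"
    using * by (simp add: algebra_simps)
  then have "eval_x 0 u + h * eval_x 0 q = 0"
    using assms(2) by simp
  then have "X dvd u + lift_x h * q" "X dvd v - lift_x h * p"
    using h by (auto intro!: eval_x_eq_0_imp_X_dvd
      simp: eval_x.hom_add eval_x.hom_minus eval_x.hom_mult eval_x_lift_x)
  then obtain u' v' where "u + lift_x h * q = X * u'" "v - lift_x h * p = X * v'"
    by (auto elim!: dvdE)
  then have "u = X * u' - lift_x h * q" "v = X * v' + lift_x h * p"
    by (simp_all add: algebra_simps)
  then have "X * f = (X * u' - lift_x h * q) * p + (X * v' + lift_x h * p) * q"
    using assms(3) by simp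
  then have "X * f = X * (u' * p + v' * q)"
    by (simp add: algebra_simps)
  moreover have "X \<noteq> 0"
    by (simp add: X_def)
  ultimately show ?thesis
    by auto
qed

lemma X_power_cancel_ideal:
  assumes "coprime (eval_x 0 p) (eval_x 0 q)" "eval_x 0 p \<noteq> 0" "\<exists>u v. X ^ N * f = u * p + v * q"
  shows "\<exists>u v. f = u * p + v * q"
  using assms(3)
proof (induction N)
  case (Suc N)
  then show ?case
    using X_cancel_ideal[OF assms(1,2), of "X ^ N * f"] by (auto simp: mult.assoc)
qed auto

lemma no_syzygy_coprime:
  assumes hom: "homogeneous (int n) p" "homogeneous (int n) q" "homogeneous (int n) w"
    and "no_common_zero p q w" and p: "eval3 p 0 0 1 \<noteq> 0"
    and cop: "coprime (eval_x 0 p) (eval_x 0 q)" "coprime (eval_x 1 p) (eval_x 1 q)"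
    and abc: "homogeneous r a" "homogeneous r b" "homogeneous r c" "r < int n"
    and syz: "a * p + b * q + c * w = 0"
  shows "a = 0 \<and> b = 0 \<and> c = 0"
proof -
  have "p \<noteq> 0"
    using p by auto
  then obtain N u v t where N: "X ^ N = u * p + v * q + t * w"
    using X_power_in_ideal[OF hom assms(4) cop(2)] by blast
  have cw: "c * w = - a * p - b * q"
    using syz by (simp add: algebra_simps add_eq_0_iff)
  \<comment> \<open>The syzygy replaces \<open>c * w\<close> by a combination of \<open>p\<close>
    and \<open>q\<close>.\<close>
  have "X ^ N * c = c * u * p + c * v * q + t * (c * w)"
    unfolding N by (simp add: algebra_simps)
  also have "\<dots> = (c * u - t * a) * p + (c * v - t * b) * q"
    unfolding cw by (simp add: algebra_simps)
  finally have "\<exists>u v. X ^ N * c = u * p + v * q"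
    by blast
  moreover have "eval_x 0 p \<noteq> 0"
    using is_unit_lead_coeff_eval_x[OF hom(1) p, of 0] by auto
  ultimately obtain u v where "c = u * p + v * q"
    using X_power_cancel_ideal[OF cop(1)] by blast
  \<comment> \<open>Elements of \<open>(p, q)\<close> have order at least \<open>n\<close>, but
    \<open>c\<close> has degree \<open>r < n\<close>.\<close>
  moreover have "order_ge (0 + int n) (u * p + v * q)"
    by (intro order_ge.add order_ge.mult order_ge_0 homogeneous_imp_order_ge hom)
  ultimately have c: "c = 0"
    using order_ge_homogeneous_less[OF _ abc(3,4)] by simp
  have 1: "eval_x 1 a * eval_x 1 p + eval_x 1 b * eval_x 1 q = 0"
    using arg_cong[OF syz, of "eval_x 1"] c by (simp add: eval_x.hom_mult eval_x.hom_add)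
  then have "eval_x 1 p dvd eval_x 1 b * eval_x 1 q"
    by (metis dvd_0_right dvd_add_right_iff dvd_triv_right)
  then have dvd: "eval_x 1 p dvd eval_x 1 b"
    using cop(2) by (simp add: coprime_dvd_mult_left_iff)
  \<comment> \<open>At \<open>x = 1\<close>, \<open>p\<close> has degree exactly \<open>n\<close> in
    \<open>z\<close> and \<open>b\<close> has degree at most \<open>r\<close>, against
    divisibility.\<close>
  have "b = 0"
  proof (rule ccontr)
    assume "b \<noteq> 0"
    then have "eval_x 1 b \<noteq> 0" "0 \<le> r"
      using eval_x_1_eq_0_imp_eq_0[OF abc(2)] homogeneous_neg[OF abc(2)] by force+
    then have "n \<le> degree (eval_x 1 b)" "degree (eval_x 1 b) \<le> nat r"
      using dvd_imp_degree_le[OF dvd] coeff_eval_x_top(2)[of "nat r" b 1] abc(2)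
      by (auto simp: degree_eval_x[OF hom(1) p])
    then show False
      using abc(4) \<open>0 \<le> r\<close> by simp
  qed
  moreover from this have "a = 0"
    using syz c \<open>p \<noteq> 0\<close> by simp
  ultimately show ?thesis
    using c by blast
qed

lemma ideal_and_syzygies_if_nonzero_at_001:
  assumes hom: "homogeneous (int n) p" "homogeneous (int n) q" "homogeneous (int n) w"
    and ncz: "no_common_zero p q w" and p: "eval3 p 0 0 1 \<noteq> 0"
  shows "\<exists>N u v t. X ^ N = u * p + v * q + t * w"
    and "homogeneous r a \<Longrightarrow> homogeneous r b \<Longrightarrow> homogeneous r c \<Longrightarrow> r < int n \<Longrightarrow>
      a * p + b * q + c * w = 0 \<Longrightarrow> a = 0 \<and> b = 0 \<and> c = 0"
proof -
  obtain s where s: "coprime (eval_x 0 p) (eval_x 0 (q + const3 s * w))"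
      "coprime (eval_x 1 p) (eval_x 1 (q + const3 s * w))"
    using ex_coprime_combination[OF hom(1) p ncz] by blast
  have hom': "homogeneous (int n) (q + const3 s * w)"
    by (intro homogeneous.add homogeneous_const3_mult hom)
  have ncz': "no_common_zero p (q + const3 s * w) w"
    unfolding no_common_zero_def
  proof (intro allI impI)
    fix x y z
    assume *: "eval3 p x y z = 0 \<and> eval3 (q + const3 s * w) x y z = 0 \<and> eval3 w x y z = 0"
    then have "eval3 q x y z = 0"
      by (auto simp: eval3.hom_add eval3.hom_mult)
    then show "x = 0 \<and> y = 0 \<and> z = 0"
      using * ncz unfolding no_common_zero_def by blast
  qed
  have "p \<noteq> 0"
    using p by auto
  then obtain N u v t where "X ^ N = u * p + v * (q + const3 s * w) + t * w"
    using X_power_in_ideal[OF hom(1) hom' hom(3) ncz' s(2)] by blast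
  also have "\<dots> = u * p + v * q + (t + const3 s * v) * w"
    by (simp add: algebra_simps)
  finally show "\<exists>N u v t. X ^ N = u * p + v * q + t * w"
    by blast
  assume abc: "homogeneous r a" "homogeneous r b" "homogeneous r c" "r < int n"
    "a * p + b * q + c * w = 0"
  \<comment> \<open>A syzygy \<open>(a, b, c)\<close> of \<open>(p, q, w)\<close> turns into
    \<open>(a, b, c - s b)\<close> for \<open>(p, q + s w, w)\<close>.\<close>
  have "a = 0 \<and> b = 0 \<and> c - const3 s * b = 0"
    using abc
    by (intro no_syzygy_coprime[OF hom(1) hom' hom(3) ncz' p s, of r] homogeneous.diff homogeneous_const3_mult)
      (simp_all add: algebra_simps)
  then show "a = 0 \<and> b = 0 \<and> c = 0"
    by auto
qed

section \<open>Three forms in arbitrary position\<close>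

lemma no_common_zero_permute:
  "no_common_zero p q w \<Longrightarrow> no_common_zero q p w"
  "no_common_zero p q w \<Longrightarrow> no_common_zero w q p"
  unfolding no_common_zero_def by blast+

text \<open>\<open>(0, 0, 1)\<close> is not a common zero; a form that is nonzero there can be
  permuted to the front.\<close>

lemma no_common_zero_cases:
  assumes "no_common_zero p q w"
  obtains "eval3 p 0 0 1 \<noteq> 0" | "eval3 q 0 0 1 \<noteq> 0" | "eval3 w 0 0 1 \<noteq> 0"
  using assms unfolding no_common_zero_def by (metis zero_neq_one)

lemma X_power_in_ideal_of_no_common_zero:
  assumes "homogeneous (int n) p" "homogeneous (int n) q" "homogeneous (int n) w"
    and "no_common_zero p q w"
  shows "\<exists>N u v t. X ^ N = u * p + v * q + t * w"
  using assms(4)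
proof (cases rule: no_common_zero_cases)
  case 1
  then show ?thesis by (rule ideal_and_syzygies_if_nonzero_at_001(1)[OF assms])
next
  case 2
  then obtain N u v t where "X ^ N = u * q + v * p + t * w"
    using ideal_and_syzygies_if_nonzero_at_001(1)[OF assms(2,1,3) no_common_zero_permute(1)[OF assms(4)]] by blast
  then have "X ^ N = v * p + u * q + t * w"
    by simp
  then show ?thesis by blast
next
  case 3
  then obtain N u v t where "X ^ N = u * w + v * q + t * p"
    using ideal_and_syzygies_if_nonzero_at_001(1)[OF assms(3,2,1) no_common_zero_permute(2)[OF assms(4)]] by blast
  then have "X ^ N = t * p + v * q + u * w"
    by simp
  then show ?thesis by blast
qed

lemma no_syzygy_of_no_common_zero:
  assumes hom: "homogeneous (int n) p" "homogeneous (int n) q" "homogeneous (int n) w"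
    and "no_common_zero p q w"
    and abc: "homogeneous r a" "homogeneous r b" "homogeneous r c" "r < int n"
    and syz: "a * p + b * q + c * w = 0"
  shows "a = 0 \<and> b = 0 \<and> c = 0"
  using assms(4)
proof (cases rule: no_common_zero_cases)
  case 1
  then show ?thesis
    by (rule ideal_and_syzygies_if_nonzero_at_001(2)[OF assms(1-4) _ abc syz])
next
  case 2
  moreover have "b * q + a * p + c * w = 0"
    using syz by (simp add: add_ac)
  ultimately show ?thesis
    using ideal_and_syzygies_if_nonzero_at_001(2)[OF hom(2,1,3) no_common_zero_permute(1)[OF assms(4)] _ abc(2,1,3,4)] by blast
next
  case 3
  moreover have "c * w + b * q + a * p = 0"
    using syz by (simp add: algebra_simps)
  ultimately show ?thesis
    using ideal_and_syzygies_if_nonzero_at_001(2)[OF hom(3,2,1) no_common_zero_permute(2)[OF assms(4)] _ abc(3,2,1,4)] by blast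
qed

subsection \<open>Partial derivatives\<close>

definition derivation :: "('a::comm_ring_1 \<Rightarrow> 'a) \<Rightarrow> bool" where
  "derivation D \<longleftrightarrow> (\<forall>p q. D (p + q) = D p + D q) \<and> (\<forall>p q. D (p * q) = p * D q + q * D p)"

lemma derivation_0: "derivation D \<Longrightarrow> D 0 = 0"
  unfolding derivation_def by (metis add_cancel_left_right)

lemma derivation_sum: "derivation D \<Longrightarrow> D (\<Sum>i\<in>I. f i) = (\<Sum>i\<in>I. D (f i))"
  by (induction I rule: infinite_finite_induct) (auto simp: derivation_0, auto simp: derivation_def)

lemma derivation_pderiv: "derivation (pderiv :: 'a::idom poly \<Rightarrow> 'a poly)"
  unfolding derivation_def by (simp add: pderiv_add pderiv_mult)

text \<open>The extension of \<open>D\<close> that kills the new variable; the Leibniz rule is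
  checked on the coefficients of the product.\<close>

lemma derivation_map_poly:
  assumes "derivation D"
  shows "derivation (map_poly D)"
  unfolding derivation_def
proof (intro conjI allI poly_eqI)
  fix p q n
  show "coeff (map_poly D (p + q)) n = coeff (map_poly D p + map_poly D q) n"
    using assms by (simp add: coeff_map_poly derivation_0) (simp add: derivation_def)
  have "coeff (map_poly D (p * q)) n = (\<Sum>i\<le>n. coeff p i * D (coeff q (n - i)) + coeff q (n - i) * D (coeff p i))"
    using assms by (simp add: coeff_map_poly derivation_0 coeff_mult derivation_sum) (simp add: derivation_def)
  also have "\<dots> = coeff (p * map_poly D q + map_poly D p * q) n"
    using assms by (simp add: coeff_map_poly derivation_0 coeff_mult sum.distrib) (simp add: mult.commute)
  finally show "coeff (map_poly D (p * q)) n = coeff (p * map_poly D q + q * map_poly D p) n"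
    by (simp add: mult.commute)
qed

lemma derivation_partial: "derivation partial_x" "derivation partial_y" "derivation partial_z"
  unfolding partial_x_def partial_y_def partial_z_def
  by (intro derivation_map_poly derivation_pderiv)+

lemma derivation_mult: "derivation D \<Longrightarrow> D (p * q) = p * D q + q * D p"
  by (simp add: derivation_def)

lemmas partial_mult = derivation_partial[THEN derivation_mult]

lemma coeff3_partial_x: "coeff3 (partial_x p) i j k = of_nat (Suc i) * coeff3 p (Suc i) j k"
  and coeff3_partial_y: "coeff3 (partial_y p) i j k = of_nat (Suc j) * coeff3 p i (Suc j) k"
  and coeff3_partial_z: "coeff3 (partial_z p) i j k = of_nat (Suc k) * coeff3 p i j (Suc k)"
proof -
  have const: "coeff (of_nat n * r) i = of_nat n * coeff r i" for n i and r :: "'a::comm_ring_1 poly"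
    by (metis coeff_smult of_nat_poly smult_conv_mult_const)
  show "coeff3 (partial_x p) i j k = of_nat (Suc i) * coeff3 p (Suc i) j k"
    by (simp add: partial_x_def coeff3_def coeff_map_poly coeff_pderiv del: of_nat_Suc)
  show "coeff3 (partial_y p) i j k = of_nat (Suc j) * coeff3 p i (Suc j) k"
    by (simp add: partial_y_def coeff3_def coeff_map_poly coeff_pderiv const del: of_nat_Suc)
  show "coeff3 (partial_z p) i j k = of_nat (Suc k) * coeff3 p i j (Suc k)"
    by (simp add: partial_z_def coeff3_def coeff_pderiv const del: of_nat_Suc)
qed

lemma coeff3_X_mult: "coeff3 (X * p) i j k = (case i of 0 \<Rightarrow> 0 | Suc i \<Rightarrow> coeff3 p i j k)"
  and coeff3_Y_mult: "coeff3 (Y * p) i j k = (case j of 0 \<Rightarrow> 0 | Suc j \<Rightarrow> coeff3 p i j k)"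
  and coeff3_Z_mult: "coeff3 (Z * p) i j k = (case k of 0 \<Rightarrow> 0 | Suc k \<Rightarrow> coeff3 p i j k)"
  by (simp_all add: coeff3_def X_def Y_def Z_def coeff_pCons split: nat.split)

lemma partial_const3 [simp]: "partial_x (const3 c) = 0" "partial_y (const3 c) = 0" "partial_z (const3 c) = 0"
  by (intro cpoly3_eqI; simp add: coeff3_partial_x coeff3_partial_y coeff3_partial_z coeff3_const3)+

lemma homogeneous_partial:
  assumes "homogeneous n p"
  shows "homogeneous (n - 1) (partial_x p)" "homogeneous (n - 1) (partial_y p)" "homogeneous (n - 1) (partial_z p)"
  using assms unfolding homogeneous_def coeff3_partial_x coeff3_partial_y coeff3_partial_z by force+

lemma euler:
  assumes "homogeneous (int n) p"
  shows "X * partial_x p + Y * partial_y p + Z * partial_z p = const3 (of_nat n) * p"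
proof (rule cpoly3_eqI)
  fix i j k
  have "coeff3 (X * partial_x p + Y * partial_y p + Z * partial_z p) i j k = of_nat (i + j + k) * coeff3 p i j k"
    by (simp add: coeff3_X_mult coeff3_Y_mult coeff3_Z_mult coeff3_partial_x coeff3_partial_y coeff3_partial_z
      distrib_right split: nat.split)
  then show "coeff3 (X * partial_x p + Y * partial_y p + Z * partial_z p) i j k =
      coeff3 (const3 (of_nat n) * p) i j k"
    using homogeneousD[OF assms, of i j k] by (cases "i + j + k = n") auto
qed

section \<open>Jacobian syzygies of smooth curves, alone and with a line\<close>

lemma smooth_no_common_zero_partials:
  assumes "smooth_plane_curve d q"
  shows "no_common_zero (partial_x q) (partial_y q) (partial_z q)"
  unfolding no_common_zero_def
proof (intro allI impI)
  fix a b c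
  assume *: "eval3 (partial_x q) a b c = 0 \<and> eval3 (partial_y q) a b c = 0 \<and> eval3 (partial_z q) a b c = 0"
  have q: "homogeneous (int d) q" "1 \<le> d" "\<not> singular_point q a b c"
    using assms by (auto simp: smooth_plane_curve_def plane_curve_def)
  \<comment> \<open>By Euler's formula a common zero of the partials lies on the curve and so would
    be a singular point.\<close>
  have "of_nat d * eval3 q a b c = 0"
    using arg_cong[OF euler[OF q(1)], of "\<lambda>p. eval3 p a b c"] *
    by (auto simp: eval3.hom_add eval3.hom_mult)
  then have "eval3 q a b c = 0"
    using q(2) by auto
  then show "a = 0 \<and> b = 0 \<and> c = 0"
    using q(3) * unfolding singular_point_def by blast
qed

lemma smooth_homogeneous_partials:
  assumes "smooth_plane_curve d q"
  shows "homogeneous (int (d - 1)) (partial_x q)" "homogeneous (int (d - 1)) (partial_y q)"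
    "homogeneous (int (d - 1)) (partial_z q)"
proof -
  have "homogeneous (int d) q" "int (d - 1) = int d - 1"
    using assms by (auto simp: smooth_plane_curve_def plane_curve_def)
  then show "homogeneous (int (d - 1)) (partial_x q)" "homogeneous (int (d - 1)) (partial_y q)"
    "homogeneous (int (d - 1)) (partial_z q)"
    using homogeneous_partial by simp_all
qed

lemma smooth_no_syzygy:
  assumes "smooth_plane_curve d q" "r < int d - 1"
    and "homogeneous r a" "homogeneous r b" "homogeneous r c"
    and "a * partial_x q + b * partial_y q + c * partial_z q = 0"
  shows "a = 0 \<and> b = 0 \<and> c = 0"
  using assms(2)
  by (intro no_syzygy_of_no_common_zero[OF smooth_homogeneous_partials[OF assms(1)]
      smooth_no_common_zero_partials[OF assms(1)] assms(3-5) _ assms(6)]) auto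

text \<open>A repeated factor \<open>h\<close> divides all three partials, hence a power of
  \<open>X\<close>. A prime factor of \<open>h\<close> is then associated to \<open>X\<close>, so
  \<open>X\<close> divides the partials and they all vanish at \<open>(0, 0, 1)\<close>.\<close>

lemma smooth_squarefree:
  assumes "smooth_plane_curve d q"
  shows "squarefree q"
proof (rule squarefreeI)
  fix h assume "h\<^sup>2 dvd q"
  then obtain k where k: "q = h * (h * k)"
    by (metis dvdE mult.assoc power2_eq_square)
  have dvd: "h dvd partial_x q" "h dvd partial_y q" "h dvd partial_z q"
    unfolding k partial_mult by (simp_all add: dvd_add)
  obtain N u v t where "X ^ N = u * partial_x q + v * partial_y q + t * partial_z q"
    using X_power_in_ideal_of_no_common_zero[OF smooth_homogeneous_partials[OF assms]
      smooth_no_common_zero_partials[OF assms]] by blast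
  then have hX: "h dvd X ^ N"
    using dvd by simp
  show "h dvd 1"
  proof (rule ccontr)
    assume "\<not> h dvd 1"
    moreover have "h \<noteq> 0"
      using hX by (auto simp: X_def)
    ultimately obtain p where p: "prime_elem p" "p dvd h"
      using prime_divisor_exists[of h] by auto
    then have "p dvd X"
      using hX prime_elem_dvd_power[of p X N] dvd_trans by blast
    then have "X dvd p"
      using p(1) irreducibleD'[OF prime_elem_imp_irreducible[OF prime_elem_X]] prime_elem_not_unit by blast
    then have X_dvd: "X dvd partial_x q" "X dvd partial_y q" "X dvd partial_z q"
      using p(2) dvd dvd_trans by blast+
    have "eval3 f 0 0 1 = 0" if f: "X dvd f" for f
      using f by (auto simp: eval3.hom_mult eval3_X elim!: dvdE)
    then show False
      using smooth_no_common_zero_partials[OF assms] X_dvd unfolding no_common_zero_def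
      by (metis zero_neq_one)
  qed
qed

text \<open>With \<theta> the derivation with coefficients \<open>a\<close>, \<open>b\<close>,
  \<open>c\<close>, \<open>dl\<close> is \<theta>(l) and \<open>dq\<close> is \<theta>(q).\<close>

lemma line_smooth_no_syzygy:
  assumes l: "plane_curve 1 l" and q: "smooth_plane_curve d q" and prime: "prime_elem l"
    and ndvd: "\<not> l dvd q" and r: "r < int d - 1"
    and abc: "homogeneous r a" "homogeneous r b" "homogeneous r c"
    and syz: "a * partial_x (l * q) + b * partial_y (l * q) + c * partial_z (l * q) = 0"
  shows "a = 0 \<and> b = 0 \<and> c = 0"
proof -
  have l': "homogeneous 1 l" "l \<noteq> 0" and q': "homogeneous (int d) q" "d \<ge> 1"
    using l q by (auto simp: plane_curve_def smooth_plane_curve_def)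
  define dl where "dl = a * partial_x l + b * partial_y l + c * partial_z l"
  define dq where "dq = a * partial_x q + b * partial_y q + c * partial_z q"
  have leibniz: "l * dq + q * dl = 0"
    using syz by (simp add: dl_def dq_def partial_mult algebra_simps)
  then have "l dvd q * dl"
    by (metis dvd_0_right dvd_add_right_iff dvd_triv_left)
  then obtain g where g: "dl = l * g"
    using prime ndvd by (meson prime_elem_dvd_multD dvdE)
  have "l * (dq + g * q) = 0"
    using leibniz g by (simp add: algebra_simps)
  then have dq: "dq = - g * q"
    using l'(2) by (simp add: add_eq_0_iff)
  have "homogeneous r (l * g)"
    unfolding g[symmetric] dl_def
    using homogeneous.mult[OF abc(1) homogeneous_partial(1)[OF l'(1)]]
      homogeneous.mult[OF abc(2) homogeneous_partial(2)[OF l'(1)]]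
      homogeneous.mult[OF abc(3) homogeneous_partial(3)[OF l'(1)]]
    by (intro homogeneous.add) simp_all
  then have hom_g: "homogeneous (r - 1) g"
    using homogeneous_mult_cancel l' by blast
  let ?D = "const3 (of_nat d)"
  \<comment> \<open>The derivation d \<theta> + g E kills \<open>q\<close>, since E(q) = d q by
    Euler and \<theta>(q) = - g q. As \<open>g\<close> has degree \<open>r - 1\<close>, its
    coefficients again have degree \<open>r\<close>.\<close>
  have "(?D * a + g * X) * partial_x q + (?D * b + g * Y) * partial_y q + (?D * c + g * Z) * partial_z q =
      ?D * dq + g * (X * partial_x q + Y * partial_y q + Z * partial_z q)"
    by (simp add: dq_def algebra_simps)
  also have "\<dots> = 0"
    unfolding euler[OF q'(1)] dq by simp
  finally have "?D * a + g * X = 0 \<and> ?D * b + g * Y = 0 \<and> ?D * c + g * Z = 0"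
    using homogeneous.mult[OF hom_g homogeneous_X] homogeneous.mult[OF hom_g homogeneous_Y]
      homogeneous.mult[OF hom_g homogeneous_Z] abc
    by (intro smooth_no_syzygy[OF q r] homogeneous.add homogeneous_const3_mult) simp_all
  then have abc': "?D * a = - g * X" "?D * b = - g * Y" "?D * c = - g * Z"
    by (simp_all add: add_eq_0_iff)
  \<comment> \<open>Now d \<theta> = - g E is evaluated on \<open>l\<close>, where E(l) = l; this
    gives (d + 1) g l = 0.\<close>
  have "?D * dl = (?D * a) * partial_x l + (?D * b) * partial_y l + (?D * c) * partial_z l"
    by (simp add: dl_def algebra_simps)
  also have "\<dots> = - g * (X * partial_x l + Y * partial_y l + Z * partial_z l)"
    unfolding abc' by (simp add: algebra_simps)
  also have "\<dots> = - g * l"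
    using euler[of 1 l] l'(1) by simp
  finally have "l * (const3 (of_nat d + 1) * g) = 0"
    by (simp add: g const3_add algebra_simps)
  moreover have "(of_nat d + 1 :: complex) \<noteq> 0"
    by (metis of_nat_Suc of_nat_neq_0 add.commute)
  ultimately have "g = 0"
    using l'(2) by simp
  then show ?thesis
    using abc' q'(2) by simp
qed

subsection \<open>Syzygies from free resolutions\<close>

text \<open>In degree \<open>n\<close> only the constant terms of the \<open>a j\<close> contribute.
  Relations among forms of one degree thus become linear algebra over \<complex>.\<close>

lemma homogeneous_combination_const3:
  assumes "homogeneous n p" "\<And>j. j \<in> J \<Longrightarrow> homogeneous n (h j)" "p = (\<Sum>j\<in>J. a j * h j)"
  shows "p = (\<Sum>j\<in>J. const3 (coeff3 (a j) 0 0 0) * h j)"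
proof (rule cpoly3_eqI)
  fix i j k
  have sum: "coeff3 (\<Sum>j\<in>J. f j) i j' k = (\<Sum>j\<in>J. coeff3 (f j) i j' k)" for f :: "_ \<Rightarrow> cpoly3" and j'
    by (simp add: coeff3_def coeff_sum)
  show "coeff3 p i j k = coeff3 (\<Sum>j\<in>J. const3 (coeff3 (a j) 0 0 0) * h j) i j k"
  proof (cases "int (i + j + k) = n")
    case True
    then show ?thesis
      unfolding sum assms(3) by (intro sum.cong) (auto simp: coeff3_mult_homogeneous[OF assms(2) True])
  next
    case False
    then show ?thesis
      using homogeneousD[OF assms(1) False] homogeneousD[OF assms(2) False] by (simp add: sum)
  qed
qed

text \<open>
  Either the change of generators is invertible, and syzygies are transported along it, or the new
  generators are linearly dependent, which is a syzygy of degree \<open>0\<close>.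
\<close>

lemma syzygy_change_generators:
  fixes g h v :: "nat \<Rightarrow> cpoly3"
  assumes g: "\<And>i. i < m \<Longrightarrow> homogeneous n (g i)" and h: "\<And>i. i < m \<Longrightarrow> homogeneous n (h i)"
    and gh: "\<And>i. i < m \<Longrightarrow> \<exists>a. g i = (\<Sum>j<m. a j * h j)"
    and hg: "\<And>i. i < m \<Longrightarrow> \<exists>a. h i = (\<Sum>j<m. a j * g j)"
    and v: "\<And>i. i < m \<Longrightarrow> homogeneous r (v i)" "\<exists>i<m. v i \<noteq> 0" "(\<Sum>i<m. v i * g i) = 0"
  shows "\<exists>s w. (s = 0 \<or> s = r) \<and> (\<forall>j<m. homogeneous s (w j)) \<and> (\<exists>j<m. w j \<noteq> 0) \<and> (\<Sum>j<m. w j * h j) = 0"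
proof (rule ccontr)
  assume contra: "\<not> ?thesis"
  have no_syz: "w j = 0"
    if "s = 0 \<or> s = r" "\<And>j. j < m \<Longrightarrow> homogeneous s (w j)" "(\<Sum>j<m. w j * h j) = 0" "j < m" for s w j
    using contra that by blast
  have "\<exists>b. g i = (\<Sum>j<m. const3 (b j) * h j)" if i: "i < m" for i
    using gh[OF i] homogeneous_combination_const3[OF g[OF i], of "{..<m}" h] h by (metis lessThan_iff)
  then obtain N where N: "\<And>i. i < m \<Longrightarrow> g i = (\<Sum>j<m. const3 (N i j) * h j)"
    by metis
  have "\<exists>b. h i = (\<Sum>j<m. const3 (b j) * g j)" if i: "i < m" for i
    using hg[OF i] homogeneous_combination_const3[OF h[OF i], of "{..<m}" g] g by (metis lessThan_iff)
  then obtain M where M: "\<And>i. i < m \<Longrightarrow> h i = (\<Sum>j<m. const3 (M i j) * g j)"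
    by metis
  have const3_sum: "const3 (\<Sum>i\<in>I. f i) = (\<Sum>i\<in>I. const3 (f i))" for I and f :: "nat \<Rightarrow> complex"
    by (induction I rule: infinite_finite_induct) (auto simp: const3_add)
  \<comment> \<open>Substituting one change of generators into the other expresses \<open>h\<close>
    through itself by the matrix \<open>M N\<close>. Its difference from the identity gives syzygies
    of degree 0, which are trivial here.\<close>
  have MN: "(\<Sum>k<m. M i k * N k j) = (if i = j then 1 else 0)" if i: "i < m" and j: "j < m" for i j
  proof -
    have "h i = (\<Sum>k<m. \<Sum>j<m. const3 (M i k * N k j) * h j)"
      by (subst M[OF i]) (simp add: N sum_distrib_left const3_mult mult.assoc)
    also have "\<dots> = (\<Sum>j<m. const3 (\<Sum>k<m. M i k * N k j) * h j)"
      by (subst sum.swap) (simp add: const3_sum sum_distrib_right)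
    finally have "(\<Sum>j<m. const3 ((\<Sum>k<m. M i k * N k j) - (if i = j then 1 else 0)) * h j) = 0"
      using i by (simp add: const3_diff left_diff_distrib sum_subtractf if_distrib[of const3]
        if_distrib[of "\<lambda>x. x * _"] sum.delta cong: if_cong)
    then have "const3 ((\<Sum>k<m. M i k * N k j) - (if i = j then 1 else 0)) = 0"
      using no_syz[of 0 "\<lambda>j. const3 ((\<Sum>k<m. M i k * N k j) - (if i = j then 1 else 0))" j] j by simp
    then show ?thesis
      by (simp only: const3_eq_0_iff) simp
  qed
  \<comment> \<open>A one-sided inverse of a square complex matrix is two-sided.\<close>
  define A B where "A = mat m m (\<lambda>(i, j). M i j)" and "B = mat m m (\<lambda>(i, j). N i j)"
  have AB: "A \<in> carrier_mat m m" "B \<in> carrier_mat m m"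
    by (simp_all add: A_def B_def)
  have "A * B = 1\<^sub>m m"
    by (rule eq_matI) (auto simp: A_def B_def scalar_prod_def MN atLeast0LessThan)
  then have "B * A = 1\<^sub>m m"
    by (rule mat_mult_left_right_inverse[OF AB])
  moreover have "(B * A) $$ (i, j) = (\<Sum>k<m. N i k * M k j)" if "i < m" "j < m" for i j
    using that by (simp add: A_def B_def scalar_prod_def atLeast0LessThan)
  ultimately have NM: "(\<Sum>k<m. N i k * M k j) = (if i = j then 1 else 0)" if "i < m" "j < m" for i j
    using that by (metis index_one_mat(1))
  \<comment> \<open>\<open>w\<close> is the row vector \<open>v N\<close>, a syzygy of
    \<open>h\<close> of degree \<open>r\<close>, hence 0; so \<open>v\<close>, which is
    \<open>w M\<close>, vanishes too.\<close>
  define w where "w j = (\<Sum>i<m. const3 (N i j) * v i)" for j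
  have "(\<Sum>j<m. w j * h j) = (\<Sum>i<m. v i * (\<Sum>j<m. const3 (N i j) * h j))"
    unfolding w_def sum_distrib_left sum_distrib_right by (subst sum.swap) (simp add: mult_ac)
  also have "\<dots> = 0"
    using v(3) N by simp
  finally have w: "w j = 0" if "j < m" for j
    using that v(1) by (intro no_syz[of r w]) (auto simp: w_def intro!: homogeneous.sum homogeneous_const3_mult)
  have "v k = 0" if k: "k < m" for k
  proof -
    have "v k = (\<Sum>i<m. const3 (if i = k then 1 else 0) * v i)"
      using k by (simp add: if_distrib[of const3] if_distrib[of "\<lambda>x. x * _"] sum.delta cong: if_cong)
    also have "\<dots> = (\<Sum>i<m. \<Sum>j<m. const3 (M j k) * (const3 (N i j) * v i))"
      using k by (intro sum.cong) (auto simp: NM[symmetric] const3_sum const3_mult sum_distrib_right, simp add: mult_ac)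
    also have "\<dots> = (\<Sum>j<m. const3 (M j k) * w j)"
      unfolding w_def sum_distrib_left by (rule sum.swap)
    finally show ?thesis
      using w by simp
  qed
  then show False
    using v(2) by blast
qed

lemma sum_lessThan_3: "(\<Sum>i<3. f i) = f 0 + f 1 + (f (2::nat) :: 'a::comm_monoid_add)"
  by (simp add: numeral_3_eq_3 numeral_2_eq_2 lessThan_Suc add_ac)

definition partials :: "cpoly3 \<Rightarrow> nat \<Rightarrow> cpoly3" where
  "partials f j = (if j = 0 then partial_x f else if j = 1 then partial_y f else partial_z f)"

text \<open>The entries of \<open>A1\<close> generate the Jacobian ideal but may differ from the
  partials. The first column of \<open>A2\<close> is a syzygy of these entries, and it is
  transported to the partials; \<open>r = 0\<close> stands for linearly dependent partials.\<close>

lemma syzygy_of_resolution: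
  assumes f: "homogeneous (int d) f"
    and res: "minimal_free_resolution (jacobian_ideal f) (replicate 3 (int d - 1))
      (map (\<lambda>a. int d - 1 + int a) [d1, d2]) []"
  shows "\<exists>r a b c. (r = 0 \<or> r = int d1) \<and> homogeneous r a \<and> homogeneous r b \<and> homogeneous r c \<and>
    (a, b, c) \<noteq> (0, 0, 0) \<and> a * partial_x f + b * partial_y f + c * partial_z f = 0"
proof -
  obtain A1 A2 A3 where
    A1: "graded_hom (replicate 3 (int d - 1)) [0] A1" and
    A2: "graded_hom (map (\<lambda>a. int d - 1 + int a) [d1, d2]) (replicate 3 (int d - 1)) A2" and
    A3: "graded_hom [] (map (\<lambda>a. int d - 1 + int a) [d1, d2]) A3" and
    im1: "mat_image A1 = {v \<in> carrier_vec 1. v $ 0 \<in> jacobian_ideal f}" and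
    im2: "mat_image A2 = mat_kernel A1" and im3: "mat_image A3 = mat_kernel A2"
    using res unfolding minimal_free_resolution_def minimal_graded_hom_def by blast
  have carrier: "A1 \<in> carrier_mat 1 3" "A2 \<in> carrier_mat 3 2" "A3 \<in> carrier_mat 2 0"
    using A1 A2 A3 by (auto simp: graded_hom_def numeral_2_eq_2)
  define g where "g i = A1 $$ (0, i)" for i
  define v where "v i = A2 $$ (i, 0)" for i
  have hom_g: "homogeneous (int d - 1) (g i)" if "i < 3" for i
    using A1 that unfolding graded_hom_def g_def by force
  have hom_v: "homogeneous (int d1) (v i)" if "i < 3" for i
    using A2 that unfolding graded_hom_def v_def by force
  have hom_h: "homogeneous (int d - 1) (partials f i)" for i
    using homogeneous_partial[OF f] by (simp add: partials_def)
  have A1_mult: "(A1 *\<^sub>v w) $ 0 = (\<Sum>i<3. w $ i * g i)" if "w \<in> carrier_vec 3" for w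
    using carrier(1) that by (auto simp: scalar_prod_def g_def atLeast0LessThan mult.commute intro!: sum.cong)
  have col: "A2 *\<^sub>v unit_vec 2 0 \<in> mat_kernel A1"
    using carrier(2) unfolding im2[symmetric] mat_image_def by auto
  have v_eq: "(A2 *\<^sub>v unit_vec 2 0) $ i = v i" if "i < 3" for i
    using carrier(2) that by (simp add: v_def)
  have "(\<Sum>i<3. v i * g i) = (A1 *\<^sub>v (A2 *\<^sub>v unit_vec 2 0)) $ 0"
    using carrier(2) by (subst A1_mult) (auto simp: v_def intro!: sum.cong)
  also have "\<dots> = 0"
    using col carrier(1) by (simp add: mat_kernel_def)
  finally have syz: "(\<Sum>i<3. v i * g i) = 0" .
  \<comment> \<open>As the third module is zero, exactness makes \<open>A2\<close> injective, so its
    first column is nonzero.\<close>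
  have nonzero: "\<exists>i<3. v i \<noteq> 0"
  proof (rule ccontr)
    assume "\<not> ?thesis"
    then have "A2 *\<^sub>v unit_vec 2 0 = 0\<^sub>v 3"
      using carrier(2) v_eq by (intro eq_vecI) auto
    then have "unit_vec 2 0 \<in> mat_kernel A2"
      using carrier(2) by (auto simp: mat_kernel_def)
    then obtain w where w: "w \<in> carrier_vec 0" "unit_vec 2 0 = A3 *\<^sub>v w"
      using carrier(3) unfolding im3[symmetric] mat_image_def by auto
    have "(unit_vec 2 0 :: cpoly3 vec) $ 0 = 0"
      unfolding w(2) using w(1) carrier(3) by (simp add: scalar_prod_def)
    then show False
      by simp
  qed
  have gh: "\<exists>a. g i = (\<Sum>j<3. a j * partials f j)" if i: "i < 3" for i
  proof -
    have "A1 *\<^sub>v unit_vec 3 i \<in> mat_image A1"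
      using carrier(1) unfolding mat_image_def by auto
    moreover have "(A1 *\<^sub>v unit_vec 3 i) $ 0 = g i"
      using carrier(1) i by (simp add: g_def)
    ultimately have "g i \<in> jacobian_ideal f"
      unfolding im1 by auto
    then obtain a b c where "g i = a * partial_x f + b * partial_y f + c * partial_z f"
      unfolding jacobian_ideal_def by auto
    then show ?thesis
      by (intro exI[of _ "\<lambda>j. if j = 0 then a else if j = 1 then b else c"])
        (simp add: sum_lessThan_3 partials_def)
  qed
  have hg: "\<exists>a. partials f i = (\<Sum>j<3. a j * g j)" for i
  proof -
    have "\<exists>a b c. partials f i = a * partial_x f + b * partial_y f + c * partial_z f"
      unfolding partials_def
      by (intro exI[of _ "if i = 0 then 1 else 0"] exI[of _ "if i = 1 then 1 else 0"]
        exI[of _ "if i = 0 \<or> i = 1 then 0 else 1"]) auto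
    then have "vec 1 (\<lambda>_. partials f i) \<in> mat_image A1"
      unfolding im1 jacobian_ideal_def by auto
    then obtain w where w: "w \<in> carrier_vec 3" "vec 1 (\<lambda>_. partials f i) = A1 *\<^sub>v w"
      using carrier(1) unfolding mat_image_def by auto
    then have "partials f i = (\<Sum>j<3. w $ j * g j)"
      using A1_mult[OF w(1)] by (metis index_vec less_one)
    then show ?thesis
      by (intro exI[of _ "\<lambda>j. w $ j"])
  qed
  obtain s w where w: "s = 0 \<or> s = int d1" "\<forall>j<3. homogeneous s (w j)" "\<exists>j<3. w j \<noteq> 0"
      "(\<Sum>j<3. w j * partials f j) = 0"
    using syzygy_change_generators[of 3 "int d - 1" g "partials f" "int d1" v]
      hom_g hom_h gh hg hom_v nonzero syz by blast
  have "(w 0, w 1, w 2) \<noteq> (0, 0, 0)"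
    using w(3) by (auto simp: less_Suc_eq numeral_3_eq_3 numeral_2_eq_2)
  moreover have "w 0 * partial_x f + w 1 * partial_y f + w 2 * partial_z f = 0"
    using w(4) by (simp add: sum_lessThan_3 partials_def)
  ultimately show ?thesis
    using w(1,2) by (intro exI[of _ s] exI[of _ "w 0"] exI[of _ "w 1"] exI[of _ "w 2"]) auto
qed

text \<open>The smaller exponent \<open>d1\<close> is at most half of \<open>d1 + d2\<close>, which
  is \<open>d - 1\<close>; degree 0 meets the same bound.\<close>

lemma free_curve_syzygy:
  assumes "free_curve f" "homogeneous (int d) f"
  shows "\<exists>r a b c. 2 * r \<le> int d - 1 \<and> homogeneous r a \<and> homogeneous r b \<and> homogeneous r c \<and>
    (a, b, c) \<noteq> (0, 0, 0) \<and> a * partial_x f + b * partial_y f + c * partial_z f = 0"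
proof -
  obtain d' d1 d2 where *: "syzygy_curve 2 d' [d1, d2] [] f" "int d1 + int d2 = int d' - 1"
    using assms(1) unfolding free_curve_def by blast
  then have "homogeneous (int d') f" "f \<noteq> 0"
    unfolding syzygy_curve_def reduced_plane_curve_def plane_curve_def by auto
  then have "d' = d"
    using homogeneous_unique[of "int d'" f "int d"] assms(2) by simp
  moreover have "d1 \<le> d2"
    using *(1) unfolding syzygy_curve_def by simp
  moreover obtain r a b c where "r = 0 \<or> r = int d1" and
    "homogeneous r a \<and> homogeneous r b \<and> homogeneous r c \<and>
      (a, b, c) \<noteq> (0, 0, 0) \<and> a * partial_x f + b * partial_y f + c * partial_z f = 0"
    using syzygy_of_resolution[OF \<open>homogeneous (int d') f\<close>, of d1 d2] *(1)
    unfolding syzygy_curve_def by blast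
  moreover from this have "2 * r \<le> int d - 1"
    using *(2) \<open>d' = d\<close> \<open>d1 \<le> d2\<close> by auto
  ultimately show ?thesis
    by blast
qed

subsection \<open>The equation of the arrangement\<close>

text \<open>In the outermost variable that occurs, the form is linear with a nonzero constant as
  leading coefficient, hence prime. Primality persists when further variables are adjoined.\<close>

lemma prime_elem_line:
  assumes "plane_curve 1 l"
  shows "prime_elem l"
proof -
  have l: "homogeneous 1 l" "l \<noteq> 0"
    using assms by (auto simp: plane_curve_def)
  have "coeff3 l i j k = coeff3 [:[:[:0, coeff3 l 1 0 0:], [:coeff3 l 0 1 0:]:], [:[:coeff3 l 0 0 1:]:]:] i j k" for i j k
    using homogeneousD[OF l(1), of i j k]
    by (cases "i + j + k = 1")
      (auto simp: coeff3_def coeff_pCons add_is_1 split: nat.splits)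
  then have l_eq: "l = [:[:[:0, coeff3 l 1 0 0:], [:coeff3 l 0 1 0:]:], [:[:coeff3 l 0 0 1:]:]:]"
    by (rule cpoly3_eqI)
  have is_unit_coprime: "coprime a b" if "is_unit b" for a b :: "'a::algebraic_semidom"
    using that by (simp add: is_unit_right_imp_coprime)
  show ?thesis
  proof (cases "coeff3 l 0 0 1 = 0")
    case False
    then show ?thesis
      by (subst l_eq, intro prime_elem_linear_poly is_unit_coprime) (auto simp: is_unit_const_poly_iff)
  next
    case True
    have "prime_elem [:[:0, coeff3 l 1 0 0:], [:coeff3 l 0 1 0:]:]"
    proof (cases "coeff3 l 0 1 0 = 0")
      case False
      then show ?thesis
        by (intro prime_elem_linear_poly is_unit_coprime) (auto simp: is_unit_const_poly_iff)
    next
      case True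
      then have "coeff3 l 1 0 0 \<noteq> 0"
        using l(2) l_eq \<open>coeff3 l 0 0 1 = 0\<close> by auto
      then show ?thesis
        using True by (simp add: prime_elem_const_poly_iff prime_elem_linear_field_poly)
    qed
    then show ?thesis
      using True by (subst l_eq) (simp add: prime_elem_const_poly_iff)
  qed
qed

text \<open>All multiplicities are 1, so the product of the normalised prime factors is
  \<open>g\<close> up to a unit, that is, a nonzero constant.\<close>

lemma reduced_equation_squarefree:
  assumes "squarefree g"
  shows "\<exists>c. c \<noteq> 0 \<and> reduced_equation g = const3 c * g"
proof -
  have "g \<noteq> 0"
    using assms by auto
  then have "multiplicity p g = 1" if "p \<in> prime_factors g" for p
    using assms that by (simp add: squarefree_factorial_semiring')
  then have "count (prime_factorization g) p = 1" if "p \<in> prime_factors g" for p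
    using that by (metis count_prime_factorization_prime in_prime_factors_imp_prime)
  then have "count (prime_factorization g) p = count (mset_set (prime_factors g)) p" for p
    by (cases "p \<in> prime_factors g") (simp_all only: count_mset_set finite_set_mset simp_thms not_in_iff)
  then have "prime_factorization g = mset_set (prime_factors g)"
    by (rule multiset_eqI)
  from this[symmetric] have "reduced_equation g = prod_mset (prime_factorization g)"
    by (simp only: reduced_equation_def prod_unfold_prod_mset multiset.map_ident)
  then have "normalize (reduced_equation g) = normalize g"
    using \<open>g \<noteq> 0\<close> by (simp add: prod_mset_prime_factorization_weak)
  then obtain u where u: "is_unit u" "reduced_equation g = u * g"
    by (rule associatedE1)
  then obtain c where "u = const3 c" "c \<noteq> 0"
    unfolding const3_def by (metis is_unit_poly_iff not_is_unit_0)
  then show ?thesis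
    using u(2) by auto
qed

lemma homogeneous_plane_curve_const3_mult:
  "plane_curve d l \<Longrightarrow> c \<noteq> 0 \<Longrightarrow> plane_curve d (const3 c * l)"
  by (auto simp: plane_curve_def homogeneous_const3_mult)

theorem proposition4p3:
  fixes l q :: cpoly3
  assumes "plane_curve 1 l"
    and "smooth_plane_curve 4 q"
  shows "\<not> free_arrangement {l, q}"
proof
  assume "free_arrangement {l, q}"
  have l: "homogeneous 1 l" "l \<noteq> 0" and q: "homogeneous 4 q" "q \<noteq> 0"
    using assms by (auto simp: plane_curve_def smooth_plane_curve_def)
  \<comment> \<open>The degrees 1 and 4 differ, so the product over the set \<open>{l, q}\<close>
    really is \<open>l * q\<close>.\<close>
  have "l \<noteq> q"
    using homogeneous_unique[OF l(1)] l(2) q(1) by force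
  then have free: "free_curve (reduced_equation (l * q))"
    using \<open>free_arrangement {l, q}\<close> by (simp add: free_arrangement_def)
  have prime: "prime_elem l"
    using assms(1) by (rule prime_elem_line)
  have sqf: "squarefree q"
    using assms(2) by (rule smooth_squarefree)
  show False
  proof (cases "l dvd q")
    \<comment> \<open>If the line were a component of the quartic, the union would be the quartic
      itself, and a syzygy with \<open>2 * r \<le> 3\<close> is already excluded for
      \<open>q\<close>.\<close>
    case True
    then have "prime_factors (l * q) = prime_factors q"
      using dvd_prime_factors[OF q(2) True] l(2) q(2) by (simp add: prime_factors_product sup.absorb2)
    then have "reduced_equation (l * q) = reduced_equation q"
      by (simp add: reduced_equation_def)
    then obtain e where e: "e \<noteq> 0" "reduced_equation (l * q) = const3 e * q"
      using reduced_equation_squarefree[OF sqf] by auto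
    have "homogeneous (int 4) (const3 e * q)"
      using q(1) by (simp add: homogeneous_const3_mult)
    then obtain r a b c where r: "2 * r \<le> int 4 - 1" and hom: "homogeneous r a" "homogeneous r b" "homogeneous r c"
      and "(a, b, c) \<noteq> (0, 0, 0)"
      and syz: "a * partial_x (const3 e * q) + b * partial_y (const3 e * q) + c * partial_z (const3 e * q) = 0"
      using free_curve_syzygy free e(2) by metis
    have "const3 e * (a * partial_x q + b * partial_y q + c * partial_z q) = 0"
      using syz by (simp add: partial_mult algebra_simps)
    then have "a * partial_x q + b * partial_y q + c * partial_z q = 0"
      using e(1) by simp
    then have "a = 0 \<and> b = 0 \<and> c = 0"
      using r by (intro smooth_no_syzygy[OF assms(2) _ hom]) simp_all
    then show False
      using \<open>(a, b, c) \<noteq> (0, 0, 0)\<close> by simp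
  next
    case False
    have "squarefree (l * q)"
      using prime_elem_imp_coprime[OF prime False] squarefree_prime_elem[OF prime] sqf
      by (rule squarefree_mult_coprime)
    then obtain e where e: "e \<noteq> 0" "reduced_equation (l * q) = const3 e * l * q"
      using reduced_equation_squarefree by (metis mult.assoc)
    \<comment> \<open>The constant \<open>e\<close> is absorbed into the line. The union has degree
      5, so \<open>r \<le> 2\<close>, which is below 3.\<close>
    have line: "plane_curve 1 (const3 e * l)"
      using assms(1) e(1) by (rule homogeneous_plane_curve_const3_mult)
    have "homogeneous (int 5) (const3 e * l * q)"
      using homogeneous.mult[OF homogeneous_const3_mult[OF l(1)] q(1)] by simp
    then obtain r a b c where "2 * r \<le> int 5 - 1" "homogeneous r a" "homogeneous r b" "homogeneous r c"
      and "(a, b, c) \<noteq> (0, 0, 0)"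
      and "a * partial_x (const3 e * l * q) + b * partial_y (const3 e * l * q) + c * partial_z (const3 e * l * q) = 0"
      using free_curve_syzygy free e(2) by metis
    moreover have "\<not> const3 e * l dvd q"
      using False by (meson dvd_mult_right)
    ultimately have "a = 0 \<and> b = 0 \<and> c = 0"
      by (intro line_smooth_no_syzygy[OF line assms(2) prime_elem_line[OF line]]) auto
    then show False
      using \<open>(a, b, c) \<noteq> (0, 0, 0)\<close> by simp
  qed
qed

end
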